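(* Any concrete instance $H$ of a $!$-graph $G$ has an instantiation in expansion-normal form, i.e. a finite sequence consisting only of $\mathrm{EXP}$ and $\mathrm{KILL}$ operations, each of depth $0$ at the point it is applied, which transforms $G$ into a graph isomorphic to $H$.
   Context: Fix a compressed monoidal signature $T=(O,M,\mathrm{dom},\mathrm{cod})$, $\mathrm{dom},\mathrm{cod}: M \rightarrow (O\times\{\mathsf{v},\mathsf{f}\})^*$. The derived compressed typegraph $\mathcal{G}_T$ has vertex set $O\sqcup M$, a self-loop on each $X\in O$, an edge $\mathrm{in}^a_{f,i}$ from $X$ to $f$ for each $f\in M$ and index $i$ with $\mathrm{dom}(f)[i]=(X,a)$, and an edge $\mathrm{out}^a_{f,j}$ from $f$ to $X$ for each index $j$ with $\mathrm{cod}(f)[j]=(X,a)$. $\mathcal{G}_{T!}$ is $\mathcal{G}_T$ plus a vertex $!$, a self-loop on $!$, and an edge from $!$ to each vertex of $\mathcal{G}_T$. For a finite directed multigraph $G$ typed over $\mathcal{G}_{T!}$, vertices typed in $O$, $M$, $!$ are wire-, node-, $!$-vertices; fixed-arity edges are those typed by an $\mathsf{f}$-tagged edge; $U$ deletes $!$-vertices and incident edges. A string graph is a $\mathcal{G}_T$-typed graph whose typing restricts at each node-vertex to a bijection on incident fixed-arity edges and whose wire-vertices have at most one incoming and one outgoing edge. An open subgraph $O'$ of a string graph $K$ is a string subgraph with no vertex adjacent to a wire-vertex outside $O'$ and no incident fixed-arity edge outside $O'$. $B(b)$ is the full subgraph on successors of a $!$-vertex $b$, $\beta(G)$ the full subgraph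 on $!$-vertices. A $!$-graph is a $\mathcal{G}_{T!}$-typed graph with $U(G)$ a string graph, $\beta(G)$ posetal (at most one edge between two vertices, edge relation a partial order), $U(B(b))$ open in $U(G)$ for each $!$-vertex $b$, and $B(b')\subseteq B(b)$ whenever $b'\in B(b)$; it is concrete if it has no $!$-vertices. Writing $G\setminus H$ for the full subgraph on vertices not in $H$, the $!$-box operations at a $!$-vertex $b$ are: $\mathrm{COPY}_b(G)$, the pushout in $\mathbf{Graph}/\mathcal{G}_{T!}$ of $G\hookleftarrow G\setminus B(b)\hookrightarrow G$ (in which $b$ has two copies $b^0,b^1$, its images under the two coprojections); $\mathrm{DROP}_b(G)=G\setminus\{b\}$; $\mathrm{KILL}_b(G) = G\setminus B(b)$. $\mathrm{EXP}_b$ abbreviates $\mathrm{COPY}_b$ followed by $\mathrm{DROP}_{b^1}$. An instantiation of $H$ from $G$ is a finite sequence of operations, each applied to a $!$-vertex of the current graph, starting from $G$ and yielding a graph isomorphic to $H$; $H$ is a (concrete) instance of $G$ if such a sequence exists (and $H$ is concrete). The depth of a $!$-vertex $b$ is $\delta(b)=0$ if $b$ has no predecessors other than itself, and otherwise $1+\max\{\delta(c): c\neq b,\ c\text{ has an edge to } b\}$; the depth of an operation (including $\mathrm{EXP}_b$) is the depth of the $!$-vertex it acts on in the graph to which it is applied. *)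

theory Defs
  imports
    "Graph_Theory.Digraph_Component"
    "HOL-Library.Infinite_Typeclass"
begin

subsection \<open>Compressed monoidal signatures and their typegraphs\<close>

datatype arity = Var_arity | Fix_arity

record ('o, 'm) signature =
  sig_obj :: "'o set"
  sig_mor :: "'m set"
  sig_dom :: "'m \<Rightarrow> ('o \<times> arity) list"
  sig_cod :: "'m \<Rightarrow> ('o \<times> arity) list"

definition wf_signature :: "('o, 'm) signature \<Rightarrow> bool" where
  "wf_signature T \<longleftrightarrow>
    (\<forall>f \<in> sig_mor T. fst ` set (sig_dom T f) \<subseteq> sig_obj T \<and> fst ` set (sig_cod T f) \<subseteq> sig_obj T)"

datatype ('o, 'm) tvert = Obj 'o | Mor 'm | Bang

datatype ('o, 'm) tedge =
    Obj_loop 'o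
  | In_edge arity 'm nat
  | Out_edge arity 'm nat
  | Bang_loop
  | Bang_to "('o, 'm) tvert"

fun tedge_tail :: "('o, 'm) signature \<Rightarrow> ('o, 'm) tedge \<Rightarrow> ('o, 'm) tvert" where
  "tedge_tail T (Obj_loop X) = Obj X"
| "tedge_tail T (In_edge a f i) = Obj (fst (sig_dom T f ! i))"
| "tedge_tail T (Out_edge a f j) = Mor f"
| "tedge_tail T Bang_loop = Bang"
| "tedge_tail T (Bang_to x) = Bang"

fun tedge_head :: "('o, 'm) signature \<Rightarrow> ('o, 'm) tedge \<Rightarrow> ('o, 'm) tvert" where
  "tedge_head T (Obj_loop X) = Obj X"
| "tedge_head T (In_edge a f i) = Mor f"
| "tedge_head T (Out_edge a f j) = Obj (fst (sig_cod T f ! j))"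
| "tedge_head T Bang_loop = Bang"
| "tedge_head T (Bang_to x) = x"

definition typegraph :: "('o, 'm) signature \<Rightarrow> (('o, 'm) tvert, ('o, 'm) tedge) pre_digraph" where
  "typegraph T = \<lparr>
    verts = Obj ` sig_obj T \<union> Mor ` sig_mor T,
    arcs = Obj_loop ` sig_obj T
      \<union> {In_edge a f i | a f i. f \<in> sig_mor T \<and> i < length (sig_dom T f) \<and> snd (sig_dom T f ! i) = a}
      \<union> {Out_edge a f j | a f j. f \<in> sig_mor T \<and> j < length (sig_cod T f) \<and> snd (sig_cod T f ! j) = a},
    tail = tedge_tail T,
    head = tedge_head T \<rparr>"

definition bang_typegraph :: "('o, 'm) signature \<Rightarrow> (('o, 'm) tvert, ('o, 'm) tedge) pre_digraph" where
  "bang_typegraph T = \<lparr>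
    verts = insert Bang (verts (typegraph T)),
    arcs = arcs (typegraph T) \<union> {Bang_loop} \<union> Bang_to ` verts (typegraph T),
    tail = tedge_tail T,
    head = tedge_head T \<rparr>"

definition fixed_tedge :: "('o, 'm) tedge \<Rightarrow> bool" where
  "fixed_tedge t \<longleftrightarrow> (\<exists>f i. t = In_edge Fix_arity f i \<or> t = Out_edge Fix_arity f i)"


subsection \<open>Typed graphs: the slice category over a typegraph\<close>

text \<open>The maps \<open>vtyp\<close> and \<open>etyp\<close> are the vertex and edge part of the typing morphism; only their
  values on the vertices and arcs of the underlying graph matter.\<close>

record ('v, 'e, 'o, 'm) tgraph =
  und :: "('v, 'e) pre_digraph"
  vtyp :: "'v \<Rightarrow> ('o, 'm) tvert"
  etyp :: "'e \<Rightarrow> ('o, 'm) tedge"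

definition graph_hom ::
    "('v, 'e) pre_digraph \<Rightarrow> ('w, 'd) pre_digraph \<Rightarrow> ('v \<Rightarrow> 'w) \<times> ('e \<Rightarrow> 'd) \<Rightarrow> bool" where
  "graph_hom G H f \<longleftrightarrow>
    (\<forall>v \<in> verts G. fst f v \<in> verts H) \<and>
    (\<forall>e \<in> arcs G. snd f e \<in> arcs H \<and>
       tail H (snd f e) = fst f (tail G e) \<and> head H (snd f e) = fst f (head G e))"

definition typed_over ::
    "(('o, 'm) tvert, ('o, 'm) tedge) pre_digraph \<Rightarrow> ('v, 'e, 'o, 'm) tgraph \<Rightarrow> bool" where
  "typed_over \<T> G \<longleftrightarrow> wf_digraph (und G) \<and> graph_hom (und G) \<T> (vtyp G, etyp G)"

definition tg_hom ::
    "('v, 'e, 'o, 'm) tgraph \<Rightarrow> ('w, 'd, 'o, 'm) tgraph \<Rightarrow> ('v \<Rightarrow> 'w) \<times> ('e \<Rightarrow> 'd) \<Rightarrow> bool" where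
  "tg_hom G H f \<longleftrightarrow> graph_hom (und G) (und H) f \<and>
    (\<forall>v \<in> verts (und G). vtyp H (fst f v) = vtyp G v) \<and>
    (\<forall>e \<in> arcs (und G). etyp H (snd f e) = etyp G e)"

definition hom_comp ::
    "('w \<Rightarrow> 'x) \<times> ('d \<Rightarrow> 'c) \<Rightarrow> ('v \<Rightarrow> 'w) \<times> ('e \<Rightarrow> 'd) \<Rightarrow> ('v \<Rightarrow> 'x) \<times> ('e \<Rightarrow> 'c)" where
  "hom_comp g f = (fst g \<circ> fst f, snd g \<circ> snd f)"

text \<open>Equality of two morphisms with domain \<open>G\<close>; values outside \<open>G\<close> are irrelevant.\<close>

definition hom_eq ::
    "('v, 'e, 'o, 'm) tgraph \<Rightarrow> ('v \<Rightarrow> 'w) \<times> ('e \<Rightarrow> 'd) \<Rightarrow> ('v \<Rightarrow> 'w) \<times> ('e \<Rightarrow> 'd) \<Rightarrow> bool" where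
  "hom_eq G f g \<longleftrightarrow>
    (\<forall>v \<in> verts (und G). fst f v = fst g v) \<and> (\<forall>e \<in> arcs (und G). snd f e = snd g e)"

definition tg_iso :: "('v, 'e, 'o, 'm) tgraph \<Rightarrow> ('w, 'd, 'o, 'm) tgraph \<Rightarrow> bool" (infix \<open>\<simeq>\<close> 50) where
  "G \<simeq> H \<longleftrightarrow> (\<exists>f. tg_hom G H f \<and>
    bij_betw (fst f) (verts (und G)) (verts (und H)) \<and>
    bij_betw (snd f) (arcs (und G)) (arcs (und H)))"

text \<open>\<open>P\<close> with coprojections \<open>p\<close>, \<open>q\<close> is a pushout of the span \<open>A \<leftarrow> C \<rightarrow> B\<close> with legs \<open>f\<close>, \<open>g\<close> in the
  category of graphs typed over \<open>\<T>\<close>. The test objects \<open>Q\<close> range over the graphs on the same vertex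
  and edge types as \<open>P\<close>; for finite graphs over infinite types the pushout exists there and is
  determined up to isomorphism.\<close>

definition is_pushout ::
    "(('o, 'm) tvert, ('o, 'm) tedge) pre_digraph \<Rightarrow>
     ('v, 'e, 'o, 'm) tgraph \<Rightarrow> ('v, 'e, 'o, 'm) tgraph \<Rightarrow> ('v, 'e, 'o, 'm) tgraph \<Rightarrow>
     ('v \<Rightarrow> 'v) \<times> ('e \<Rightarrow> 'e) \<Rightarrow> ('v \<Rightarrow> 'v) \<times> ('e \<Rightarrow> 'e) \<Rightarrow>
     ('v, 'e, 'o, 'm) tgraph \<Rightarrow> ('v \<Rightarrow> 'v) \<times> ('e \<Rightarrow> 'e) \<Rightarrow> ('v \<Rightarrow> 'v) \<times> ('e \<Rightarrow> 'e) \<Rightarrow> bool" where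
  "is_pushout \<T> C A B f g P p q \<longleftrightarrow>
    typed_over \<T> P \<and> tg_hom A P p \<and> tg_hom B P q \<and>
    hom_eq C (hom_comp p f) (hom_comp q g) \<and>
    (\<forall>(Q :: ('v, 'e, 'o, 'm) tgraph) h k.
      typed_over \<T> Q \<and> tg_hom A Q h \<and> tg_hom B Q k \<and> hom_eq C (hom_comp h f) (hom_comp k g) \<longrightarrow>
      (\<exists>u. tg_hom P Q u \<and> hom_eq A (hom_comp u p) h \<and> hom_eq B (hom_comp u q) k \<and>
        (\<forall>u'. tg_hom P Q u' \<and> hom_eq A (hom_comp u' p) h \<and> hom_eq B (hom_comp u' q) k \<longrightarrow>
           hom_eq P u' u)))"

definition full_sub :: "('v, 'e, 'o, 'm) tgraph \<Rightarrow> 'v set \<Rightarrow> ('v, 'e, 'o, 'm) tgraph" where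
  "full_sub G V = G\<lparr>und := und G \<restriction> (verts (und G) \<inter> V)\<rparr>"

definition remove_verts :: "('v, 'e, 'o, 'm) tgraph \<Rightarrow> 'v set \<Rightarrow> ('v, 'e, 'o, 'm) tgraph" where
  "remove_verts G W = full_sub G (- W)"

definition tg_subgraph :: "('v, 'e, 'o, 'm) tgraph \<Rightarrow> ('v, 'e, 'o, 'm) tgraph \<Rightarrow> bool" where
  "tg_subgraph S K \<longleftrightarrow> subgraph (und S) (und K) \<and>
    (\<forall>v \<in> verts (und S). vtyp S v = vtyp K v) \<and> (\<forall>e \<in> arcs (und S). etyp S e = etyp K e)"


subsection \<open>String graphs and !-graphs\<close>

definition wire_verts :: "('v, 'e, 'o, 'm) tgraph \<Rightarrow> 'v set" where
  "wire_verts G = {v \<in> verts (und G). \<exists>X. vtyp G v = Obj X}"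

definition node_verts :: "('v, 'e, 'o, 'm) tgraph \<Rightarrow> 'v set" where
  "node_verts G = {v \<in> verts (und G). \<exists>f. vtyp G v = Mor f}"

definition bang_verts :: "('v, 'e, 'o, 'm) tgraph \<Rightarrow> 'v set" where
  "bang_verts G = {v \<in> verts (und G). vtyp G v = Bang}"

definition incident_arcs :: "('v, 'e) pre_digraph \<Rightarrow> 'v \<Rightarrow> 'e set" where
  "incident_arcs G v = in_arcs G v \<union> out_arcs G v"

definition string_graph :: "('o, 'm) signature \<Rightarrow> ('v, 'e, 'o, 'm) tgraph \<Rightarrow> bool" where
  "string_graph T G \<longleftrightarrow>
    fin_digraph (und G) \<and> typed_over (typegraph T) G \<and>
    (\<forall>v \<in> node_verts G.
      bij_betw (etyp G)
        {e \<in> incident_arcs (und G) v. fixed_tedge (etyp G e)}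
        {t \<in> incident_arcs (typegraph T) (vtyp G v). fixed_tedge t}) \<and>
    (\<forall>v \<in> wire_verts G. in_degree (und G) v \<le> 1 \<and> out_degree (und G) v \<le> 1)"

definition open_subgraph ::
    "('o, 'm) signature \<Rightarrow> ('v, 'e, 'o, 'm) tgraph \<Rightarrow> ('v, 'e, 'o, 'm) tgraph \<Rightarrow> bool" where
  "open_subgraph T S K \<longleftrightarrow>
    string_graph T S \<and> tg_subgraph S K \<and>
    (\<forall>v \<in> verts (und S). \<forall>w \<in> wire_verts K - verts (und S).
      (v, w) \<notin> arcs_ends (und K) \<and> (w, v) \<notin> arcs_ends (und K)) \<and>
    (\<forall>v \<in> verts (und S). \<forall>e \<in> incident_arcs (und K) v.
      fixed_tedge (etyp K e) \<longrightarrow> e \<in> arcs (und S))"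

definition unbang :: "('v, 'e, 'o, 'm) tgraph \<Rightarrow> ('v, 'e, 'o, 'm) tgraph" where
  "unbang G = remove_verts G (bang_verts G)"

definition bang_part :: "('v, 'e, 'o, 'm) tgraph \<Rightarrow> ('v, 'e, 'o, 'm) tgraph" where
  "bang_part G = full_sub G (bang_verts G)"

definition bang_box :: "('v, 'e, 'o, 'm) tgraph \<Rightarrow> 'v \<Rightarrow> ('v, 'e, 'o, 'm) tgraph" where
  "bang_box G b = full_sub G {v. (b, v) \<in> arcs_ends (und G)}"

definition posetal :: "('v, 'e) pre_digraph \<Rightarrow> bool" where
  "posetal G \<longleftrightarrow> nomulti_digraph G \<and> partial_order_on (verts G) (arcs_ends G)"

definition bang_graph :: "('o, 'm) signature \<Rightarrow> ('v, 'e, 'o, 'm) tgraph \<Rightarrow> bool" where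
  "bang_graph T G \<longleftrightarrow>
    fin_digraph (und G) \<and> typed_over (bang_typegraph T) G \<and>
    string_graph T (unbang G) \<and>
    posetal (und (bang_part G)) \<and>
    (\<forall>b \<in> bang_verts G. open_subgraph T (unbang (bang_box G b)) (unbang G)) \<and>
    (\<forall>b \<in> bang_verts G. \<forall>b' \<in> bang_verts G.
      b' \<in> verts (und (bang_box G b)) \<longrightarrow> tg_subgraph (bang_box G b') (bang_box G b))"

definition concrete :: "('v, 'e, 'o, 'm) tgraph \<Rightarrow> bool" where
  "concrete G \<longleftrightarrow> bang_verts G = {}"


subsection \<open>!-box operations\<close>

text \<open>\<open>G'\<close> is a result of copying \<open>b\<close> in \<open>G\<close>, and \<open>b0\<close>, \<open>b1\<close> are the two copies of \<open>b\<close> in it. This is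
  a relation because a pushout is determined only up to isomorphism.\<close>

definition is_copy ::
    "('o, 'm) signature \<Rightarrow> 'v \<Rightarrow> ('v, 'e, 'o, 'm) tgraph \<Rightarrow> ('v, 'e, 'o, 'm) tgraph \<Rightarrow> 'v \<Rightarrow> 'v \<Rightarrow> bool" where
  "is_copy T b G G' b0 b1 \<longleftrightarrow>
    (\<exists>p q. is_pushout (bang_typegraph T)
        (remove_verts G (verts (und (bang_box G b)))) G G (id, id) (id, id) G' p q \<and>
      b0 = fst p b \<and> b1 = fst q b)"

definition drop_bang :: "'v \<Rightarrow> ('v, 'e, 'o, 'm) tgraph \<Rightarrow> ('v, 'e, 'o, 'm) tgraph" where
  "drop_bang b G = remove_verts G {b}"

definition kill_bang :: "'v \<Rightarrow> ('v, 'e, 'o, 'm) tgraph \<Rightarrow> ('v, 'e, 'o, 'm) tgraph" where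
  "kill_bang b G = remove_verts G (verts (und (bang_box G b)))"

definition is_exp ::
    "('o, 'm) signature \<Rightarrow> 'v \<Rightarrow> ('v, 'e, 'o, 'm) tgraph \<Rightarrow> ('v, 'e, 'o, 'm) tgraph \<Rightarrow> bool" where
  "is_exp T b G G' \<longleftrightarrow> (\<exists>P b0 b1. is_copy T b G P b0 b1 \<and> G' = drop_bang b1 P)"

inductive bang_step ::
    "('o, 'm) signature \<Rightarrow> ('v, 'e, 'o, 'm) tgraph \<Rightarrow> ('v, 'e, 'o, 'm) tgraph \<Rightarrow> bool" for T where
  copy: "b \<in> bang_verts G \<Longrightarrow> is_copy T b G G' b0 b1 \<Longrightarrow> bang_step T G G'"
| drop: "b \<in> bang_verts G \<Longrightarrow> bang_step T G (drop_bang b G)"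
| kill: "b \<in> bang_verts G \<Longrightarrow> bang_step T G (kill_bang b G)"

definition instance_of ::
    "('o, 'm) signature \<Rightarrow> ('v, 'e, 'o, 'm) tgraph \<Rightarrow> ('w, 'd, 'o, 'm) tgraph \<Rightarrow> bool" where
  "instance_of T G H \<longleftrightarrow> (\<exists>K. (bang_step T)\<^sup>*\<^sup>* G K \<and> K \<simeq> H)"

definition concrete_instance_of ::
    "('o, 'm) signature \<Rightarrow> ('v, 'e, 'o, 'm) tgraph \<Rightarrow> ('w, 'd, 'o, 'm) tgraph \<Rightarrow> bool" where
  "concrete_instance_of T G H \<longleftrightarrow> instance_of T G H \<and> concrete H"


subsection \<open>Depth and expansion-normal form\<close>

definition strict_pred :: "('v, 'e, 'o, 'm) tgraph \<Rightarrow> ('v \<times> 'v) set" where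
  "strict_pred G = {(c, b). c \<noteq> b \<and> (c, b) \<in> arcs_ends (und G) \<and> c \<in> bang_verts G \<and> b \<in> bang_verts G}"

text \<open>The recursion is well-founded on !-graphs, where it satisfies the expected equation
  \<open>depth_rec\<close> below.\<close>

definition depth :: "('v, 'e, 'o, 'm) tgraph \<Rightarrow> 'v \<Rightarrow> nat" where
  "depth G = wfrec (strict_pred G) (\<lambda>\<delta> b.
     if {c. (c, b) \<in> strict_pred G} = {} then 0
     else 1 + Max (\<delta> ` {c. (c, b) \<in> strict_pred G}))"

lemma wf_strict_pred:
  assumes "bang_graph T G"
  shows "wf (strict_pred G)"
proof (rule finite_acyclic_wf)
  have fin: "finite (verts (und G))"
    using assms by (simp add: bang_graph_def fin_digraph_def fin_digraph_axioms_def)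
  have "strict_pred G \<subseteq> verts (und G) \<times> verts (und G)"
    by (auto simp: strict_pred_def bang_verts_def)
  then show "finite (strict_pred G)"
    using fin by (meson finite_SigmaI finite_subset)
  have "partial_order_on (verts (und (bang_part G))) (arcs_ends (und (bang_part G)))"
    using assms by (simp add: bang_graph_def posetal_def)
  then have "acyclic (arcs_ends (und (bang_part G)) - Id)"
    by (rule partial_order_on_acyclic)
  moreover have "strict_pred G \<subseteq> arcs_ends (und (bang_part G)) - Id"
    by (auto simp: strict_pred_def bang_part_def full_sub_def bang_verts_def arcs_ends_conv
        intro!: image_eqI)
  ultimately show "acyclic (strict_pred G)"
    by (rule acyclic_subset)
qed

lemma depth_rec:
  assumes "bang_graph T G"
  shows "depth G b =
    (if {c. (c, b) \<in> strict_pred G} = {} then 0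
     else 1 + Max (depth G ` {c. (c, b) \<in> strict_pred G}))"
proof -
  let ?P = "{c. (c, b) \<in> strict_pred G}"
  have "depth G b = (if ?P = {} then 0 else 1 + Max (cut (depth G) (strict_pred G) b ` ?P))"
    unfolding depth_def by (rule wfrec[OF wf_strict_pred[OF assms]])
  moreover have "cut (depth G) (strict_pred G) b ` ?P = depth G ` ?P"
    by (rule image_cong) (auto simp: cut_apply)
  ultimately show ?thesis
    by (simp only:)
qed

inductive enf_step ::
    "('o, 'm) signature \<Rightarrow> ('v, 'e, 'o, 'm) tgraph \<Rightarrow> ('v, 'e, 'o, 'm) tgraph \<Rightarrow> bool" for T where
  exp: "b \<in> bang_verts G \<Longrightarrow> depth G b = 0 \<Longrightarrow> is_exp T b G G' \<Longrightarrow> enf_step T G G'"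
| kill: "b \<in> bang_verts G \<Longrightarrow> depth G b = 0 \<Longrightarrow> enf_step T G (kill_bang b G)"

end

theory Submission
  imports Defs
begin

text \<open>Concrete instances have a direct description. Let every !-vertex \<open>b\<close> come in finitely many numbered
  copies, where the numbers that are admissible for \<open>b\<close> may depend on the chosen copies of the !-boxes
  around \<open>b\<close>. A copy of a vertex or edge is then given by a compatible choice of copies of all !-boxes
  containing it; forgetting the !-vertices yields a concrete graph, here \<open>unbang (inflate G A)\<close> for the
  admissibility predicate \<open>A\<close>. An admissibility predicate for the result of any COPY, DROP or KILL can be
  pulled back to the original graph without changing the concrete graph it describes, so every concrete
  instance arises in this way. Conversely, \<open>unbang (inflate G A)\<close> is reached in expansion-normal form:
  take a !-vertex \<open>b\<close> of depth 0, kill it if it has no admissible copies, and otherwise use EXP to split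
  off one of them. Each EXP decreases the total number of copies of !-vertices, and each KILL keeps that
  number and decreases the number of !-vertices.\<close>

subsection \<open>Isomorphisms and full subgraphs\<close>

text \<open>Names the witness that \<open>\<simeq>\<close> hides, so that later statements can refer
  to its vertex and edge maps.\<close>

definition is_tg_iso ::
    "('v, 'e, 'o, 'm) tgraph \<Rightarrow> ('w, 'd, 'o, 'm) tgraph \<Rightarrow> ('v \<Rightarrow> 'w) \<times> ('e \<Rightarrow> 'd) \<Rightarrow> bool" where
  "is_tg_iso G H f \<longleftrightarrow> tg_hom G H f \<and>
    bij_betw (fst f) (verts (und G)) (verts (und H)) \<and>
    bij_betw (snd f) (arcs (und G)) (arcs (und H))"

lemma tg_iso_iff: "G \<simeq> H \<longleftrightarrow> (\<exists>f. is_tg_iso G H f)"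
  by (simp add: tg_iso_def is_tg_iso_def)

lemma tg_hom_id: "tg_hom G G (id, id)"
  by (simp add: tg_hom_def graph_hom_def)

lemma tg_hom_comp:
  assumes "tg_hom G H f" "tg_hom H K g"
  shows "tg_hom G K (hom_comp g f)"
  using assms by (auto simp: tg_hom_def graph_hom_def hom_comp_def)

lemma tg_iso_trans:
  assumes "G \<simeq> H" "H \<simeq> K"
  shows "G \<simeq> K"
proof -
  obtain f g where "is_tg_iso G H f" "is_tg_iso H K g"
    using assms unfolding tg_iso_iff by blast
  then have "is_tg_iso G K (hom_comp g f)"
    by (auto simp: is_tg_iso_def hom_comp_def[of g f] intro: bij_betw_trans
        dest: tg_hom_comp[of G H f K g])
  then show ?thesis unfolding tg_iso_iff by blast
qed

text \<open>Well-formedness of \<open>G\<close> puts the ends of every arc into the vertex set,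
  where the inverse vertex map undoes the given one.\<close>

lemma tg_iso_sym:
  assumes "G \<simeq> H" "wf_digraph (und G)"
  shows "H \<simeq> G"
proof -
  interpret wf_digraph "und G" by fact
  obtain f where f: "tg_hom G H f"
    and bv: "bij_betw (fst f) (verts (und G)) (verts (und H))"
    and ba: "bij_betw (snd f) (arcs (und G)) (arcs (und H))"
    using assms by (auto simp: tg_iso_def)
  let ?g = "inv_into (verts (und G)) (fst f)" and ?h = "inv_into (arcs (und G)) (snd f)"
  have gv: "?g (fst f v) = v" if "v \<in> verts (und G)" for v
    using bv that by (simp add: bij_betw_def)
  have he: "?h (snd f e) = e" if "e \<in> arcs (und G)" for e
    using ba that by (simp add: bij_betw_def)
  have imv: "verts (und H) = fst f ` verts (und G)" and ima: "arcs (und H) = snd f ` arcs (und G)"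
    using bv ba by (auto simp: bij_betw_def)
  have "tg_hom H G (?g, ?h)"
    using f by (auto simp: tg_hom_def graph_hom_def imv ima gv he)
  then show ?thesis
    using bij_betw_inv_into[OF bv] bij_betw_inv_into[OF ba] by (auto simp: tg_iso_def)
qed

lemma full_sub_simps [simp]:
  "verts (und (full_sub G S)) = verts (und G) \<inter> S"
  "arcs (und (full_sub G S)) =
     {e \<in> arcs (und G). tail (und G) e \<in> verts (und G) \<inter> S \<and> head (und G) e \<in> verts (und G) \<inter> S}"
  "tail (und (full_sub G S)) = tail (und G)"
  "head (und (full_sub G S)) = head (und G)"
  "vtyp (full_sub G S) = vtyp G"
  "etyp (full_sub G S) = etyp G"
  by (auto simp: full_sub_def)

lemma bang_verts_full_sub [simp]: "bang_verts (full_sub G S) = bang_verts G \<inter> S"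
  by (auto simp: bang_verts_def)

lemma bij_betw_Collect_iff:
  assumes "bij_betw f A B" "\<And>a. a \<in> A \<Longrightarrow> P a \<longleftrightarrow> Q (f a)"
  shows "bij_betw f {a \<in> A. P a} {b \<in> B. Q b}"
  using assms by (auto simp: bij_betw_def inj_on_def)

lemma is_tg_iso_bang_verts:
  assumes "is_tg_iso X Y f"
  shows "bij_betw (fst f) (bang_verts X) (bang_verts Y)"
  unfolding bang_verts_def using assms
  by (intro bij_betw_Collect_iff) (auto simp: is_tg_iso_def tg_hom_def)

lemma tg_iso_card_bang_verts:
  assumes "X \<simeq> Y"
  shows "finite (bang_verts X) \<longleftrightarrow> finite (bang_verts Y)" "card (bang_verts X) = card (bang_verts Y)"
  using assms is_tg_iso_bang_verts[of X Y]
  by (auto simp: tg_iso_iff dest: bij_betw_finite bij_betw_same_card)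

text \<open>Which arcs survive in a full subgraph is decided by their ends, so an isomorphism that
  matches the vertex sets also matches the surviving arcs.\<close>

lemma tg_iso_full_sub:
  assumes f: "is_tg_iso X Y f" and "wf_digraph (und X)"
    and iff: "\<And>v. v \<in> verts (und X) \<Longrightarrow> v \<in> S \<longleftrightarrow> fst f v \<in> S'"
  shows "full_sub X S \<simeq> full_sub Y S'"
proof -
  interpret wf_digraph "und X" by fact
  have hom: "tg_hom X Y f"
    and bv: "bij_betw (fst f) (verts (und X)) (verts (und Y))"
    and ba: "bij_betw (snd f) (arcs (und X)) (arcs (und Y))"
    using f by (auto simp: is_tg_iso_def)
  have "bij_betw (fst f) {v \<in> verts (und X). v \<in> S} {v \<in> verts (und Y). v \<in> S'}"
    by (rule bij_betw_Collect_iff[OF bv]) (simp add: iff)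
  moreover have "bij_betw (snd f) (arcs (und (full_sub X S))) (arcs (und (full_sub Y S')))"
    unfolding full_sub_simps using hom
    by (intro bij_betw_Collect_iff[OF ba]) (auto simp: iff tg_hom_def graph_hom_def)
  moreover have "tg_hom (full_sub X S) (full_sub Y S') f"
    using hom by (auto simp: iff tg_hom_def graph_hom_def)
  ultimately have "is_tg_iso (full_sub X S) (full_sub Y S') f"
    by (simp add: is_tg_iso_def Int_def)
  then show ?thesis unfolding tg_iso_iff by blast
qed

lemma tg_iso_unbang:
  assumes "X \<simeq> Y" "wf_digraph (und X)"
  shows "unbang X \<simeq> unbang Y"
proof -
  obtain f where f: "is_tg_iso X Y f"
    using assms(1) unfolding tg_iso_iff by blast
  show ?thesis
    unfolding unbang_def remove_verts_def
    using f by (intro tg_iso_full_sub[OF f assms(2)])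
      (auto simp: bang_verts_def is_tg_iso_def tg_hom_def graph_hom_def)
qed

lemma wf_digraph_full_sub:
  assumes "wf_digraph (und G)"
  shows "wf_digraph (und (full_sub G S))"
  using assms by (auto simp: wf_digraph_def)

lemma typed_over_full_sub:
  assumes "typed_over \<T> G"
  shows "typed_over \<T> (full_sub G S)"
  using assms by (auto simp: typed_over_def wf_digraph_full_sub graph_hom_def)

subsection \<open>The order on !-vertices\<close>

text \<open>The invariant of the operations: a !-graph with its string graph and openness conditions forgotten.\<close>

definition box_graph :: "('o, 'm) signature \<Rightarrow> ('v, 'e, 'o, 'm) tgraph \<Rightarrow> bool" where
  "box_graph T G \<longleftrightarrow>
    finite (verts (und G)) \<and> finite (arcs (und G)) \<and> typed_over (bang_typegraph T) G \<and>
    (\<forall>b \<in> bang_verts G. (b, b) \<in> arcs_ends (und G)) \<and>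
    (\<forall>a \<in> bang_verts G. \<forall>b \<in> bang_verts G.
      (a, b) \<in> arcs_ends (und G) \<longrightarrow> (b, a) \<in> arcs_ends (und G) \<longrightarrow> a = b) \<and>
    (\<forall>a \<in> bang_verts G. \<forall>b \<in> bang_verts G. \<forall>v.
      (a, b) \<in> arcs_ends (und G) \<longrightarrow> (b, v) \<in> arcs_ends (und G) \<longrightarrow> (a, v) \<in> arcs_ends (und G))"

lemma box_graphD:
  assumes "box_graph T G"
  shows "finite (verts (und G))" "finite (arcs (und G))" "typed_over (bang_typegraph T) G"
    "wf_digraph (und G)"
    "\<And>b. b \<in> bang_verts G \<Longrightarrow> (b, b) \<in> arcs_ends (und G)"
    "\<And>a b. a \<in> bang_verts G \<Longrightarrow> b \<in> bang_verts G \<Longrightarrow>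
      (a, b) \<in> arcs_ends (und G) \<Longrightarrow> (b, a) \<in> arcs_ends (und G) \<Longrightarrow> a = b"
    "\<And>a b v. a \<in> bang_verts G \<Longrightarrow> b \<in> bang_verts G \<Longrightarrow>
      (a, b) \<in> arcs_ends (und G) \<Longrightarrow> (b, v) \<in> arcs_ends (und G) \<Longrightarrow> (a, v) \<in> arcs_ends (und G)"
  using assms unfolding box_graph_def typed_over_def by blast+

lemma arcs_ends_full_sub:
  assumes "wf_digraph (und G)"
  shows "arcs_ends (und (full_sub G S)) = {(u, v) \<in> arcs_ends (und G). u \<in> S \<and> v \<in> S}"
  using assms by (auto simp: arcs_ends_conv wf_digraph_def)

text \<open>Reflexivity and antisymmetry come from the posetal !-part. Transitivity with an
  arbitrary last vertex is the nesting of boxes: the box of \<open>b\<close> lies in that of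
  \<open>a\<close>.\<close>

lemma bang_graph_imp_box_graph:
  assumes "bang_graph T G"
  shows "box_graph T G"
proof -
  have fin: "finite (verts (und G))" "finite (arcs (und G))" and wf: "wf_digraph (und G)"
    using assms by (auto simp: bang_graph_def fin_digraph_def fin_digraph_axioms_def)
  have po: "partial_order_on (bang_verts G)
      {(u, v) \<in> arcs_ends (und G). u \<in> bang_verts G \<and> v \<in> bang_verts G}"
    using assms unfolding bang_graph_def posetal_def bang_part_def
    by (simp add: arcs_ends_full_sub[OF wf] Int_absorb1 bang_verts_def Collect_restrict)
  have box: "verts (und (bang_box G b)) = {v. (b, v) \<in> arcs_ends (und G)}" for b
    using wf by (auto simp: bang_box_def arcs_ends_conv wf_digraph_def)
  have "(a, v) \<in> arcs_ends (und G)"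
    if "a \<in> bang_verts G" "b \<in> bang_verts G" "(a, b) \<in> arcs_ends (und G)"
      "(b, v) \<in> arcs_ends (und G)" for a b v
  proof -
    have "tg_subgraph (bang_box G b) (bang_box G a)"
      using assms that unfolding bang_graph_def box by blast
    then show ?thesis
      using that(4) box by (auto simp: tg_subgraph_def subgraph_def)
  qed
  moreover have "(b, b) \<in> arcs_ends (und G)" if "b \<in> bang_verts G" for b
    using po that by (auto simp: partial_order_on_def preorder_on_def refl_on_def)
  moreover have "a = b" if "a \<in> bang_verts G" "b \<in> bang_verts G" "(a, b) \<in> arcs_ends (und G)"
      "(b, a) \<in> arcs_ends (und G)" for a b
    using po that by (auto simp: partial_order_on_def antisym_def)
  ultimately show ?thesis
    using assms fin unfolding box_graph_def bang_graph_def by blast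
qed

lemma box_graph_full_sub:
  assumes "box_graph T G"
  shows "box_graph T (full_sub G S)"
  using assms typed_over_full_sub[of "bang_typegraph T" G S]
  unfolding box_graph_def arcs_ends_full_sub[OF box_graphD(4)[OF assms]] bang_verts_full_sub
  by simp blast

lemma verts_bang_box:
  assumes "box_graph T G"
  shows "verts (und (bang_box G b)) = {v. (b, v) \<in> arcs_ends (und G)}"
  using box_graphD(4)[OF assms] by (auto simp: bang_box_def arcs_ends_conv wf_digraph_def)

text \<open>A finite strict order has a minimal element, and there the recursion for
  \<open>depth\<close> takes its empty branch. Well-foundedness is derived from the box-graph
  conditions, because the graphs met along the way are tracked as box graphs and not as
  !-graphs.\<close>

lemma ex_depth_zero:
  assumes "box_graph T G" "bang_verts G \<noteq> {}"
  obtains b where "b \<in> bang_verts G" "depth G b = 0"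
    "\<And>a. a \<in> bang_verts G \<Longrightarrow> (a, b) \<in> arcs_ends (und G) \<Longrightarrow> a = b"
proof -
  have "trans (strict_pred G)"
  proof (rule transI)
    fix a b c
    assume "(a, b) \<in> strict_pred G" "(b, c) \<in> strict_pred G"
    then show "(a, c) \<in> strict_pred G"
      using box_graphD(6)[OF assms(1), of a b] box_graphD(7)[OF assms(1), of a b c]
      by (auto simp: strict_pred_def)
  qed
  moreover have "irrefl (strict_pred G)"
    by (auto simp: strict_pred_def irrefl_def)
  ultimately have acyc: "acyclic (strict_pred G)"
    by (simp add: acyclic_irrefl)
  have "strict_pred G \<subseteq> verts (und G) \<times> verts (und G)"
    by (auto simp: strict_pred_def bang_verts_def)
  then have "finite (strict_pred G)"
    using box_graphD(1)[OF assms(1)] by (meson finite_SigmaI finite_subset)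
  then have wf: "wf (strict_pred G)"
    using acyc by (rule finite_acyclic_wf)
  then obtain b where b: "b \<in> bang_verts G" "\<And>a. (a, b) \<in> strict_pred G \<Longrightarrow> a \<notin> bang_verts G"
    using assms(2) wfE_min'[of "strict_pred G" "bang_verts G"] by blast
  have in_bang: "c \<in> bang_verts G" if "(c, b) \<in> strict_pred G" for c
    using that by (simp add: strict_pred_def)
  have no_pred: "{c. (c, b) \<in> strict_pred G} = {}"
    using b(2) in_bang by blast
  then have "depth G b = 0"
    unfolding depth_def by (subst wfrec[OF wf]) simp
  moreover have "a = b" if "a \<in> bang_verts G" "(a, b) \<in> arcs_ends (und G)" for a
  proof (rule ccontr)
    assume "a \<noteq> b"
    then have "(a, b) \<in> strict_pred G"
      using that b(1) by (simp add: strict_pred_def)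
    then show False using no_pred by blast
  qed
  ultimately show thesis
    using that b(1) by blast
qed

subsection \<open>Labelled copies\<close>

text \<open>In a box graph a !-vertex is over itself, so a copy of a !-vertex carries its own number
  besides those of the boxes around it.\<close>

definition over :: "('v, 'e, 'o, 'm) tgraph \<Rightarrow> 'v \<Rightarrow> 'v set" where
  "over G v = {a \<in> bang_verts G. (a, v) \<in> arcs_ends (und G)}"

text \<open>COPY duplicates an arc as soon as one of its ends lies in the box, whence the
  union.\<close>

definition arc_over :: "('v, 'e, 'o, 'm) tgraph \<Rightarrow> 'e \<Rightarrow> 'v set" where
  "arc_over G e = over G (tail (und G) e) \<union> over G (head (und G) e)"

definition up_closed :: "('v, 'e, 'o, 'm) tgraph \<Rightarrow> 'v set \<Rightarrow> bool" where
  "up_closed G U \<longleftrightarrow> U \<subseteq> bang_verts G \<and> (\<forall>a \<in> U. over G a \<subseteq> U)"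

type_synonym 'v labelling = "'v \<Rightarrow> nat option"

text \<open>A labelling of an up-closed set of !-vertices picks a copy of each of them; whether the copy of \<open>a\<close>
  is admissible depends only on the labels of the !-vertices whose box contains \<open>a\<close>.\<close>

definition labels ::
    "('v, 'e, 'o, 'm) tgraph \<Rightarrow> ('v \<Rightarrow> 'v labelling \<Rightarrow> bool) \<Rightarrow> 'v set \<Rightarrow> 'v labelling set" where
  "labels G A U = {x. dom x = U \<and> (\<forall>a \<in> U. A a (x |` over G a))}"

text \<open>An arc copy carries labels for the boxes of both ends; restricting them to the boxes
  over one end selects the copy of that end.\<close>

definition inflate ::
    "('v, 'e, 'o, 'm) tgraph \<Rightarrow> ('v \<Rightarrow> 'v labelling \<Rightarrow> bool) \<Rightarrow>
     ('v \<times> 'v labelling, 'e \<times> 'v labelling, 'o, 'm) tgraph" where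
  "inflate G A = \<lparr>
    und = \<lparr>
      verts = (SIGMA v : verts (und G). labels G A (over G v)),
      arcs = (SIGMA e : arcs (und G). labels G A (arc_over G e)),
      tail = (\<lambda>(e, x). (tail (und G) e, x |` over G (tail (und G) e))),
      head = (\<lambda>(e, x). (head (und G) e, x |` over G (head (und G) e))) \<rparr>,
    vtyp = vtyp G \<circ> fst,
    etyp = etyp G \<circ> fst \<rparr>"

lemma inflate_simps [simp]:
  "verts (und (inflate G A)) = (SIGMA v : verts (und G). labels G A (over G v))"
  "arcs (und (inflate G A)) = (SIGMA e : arcs (und G). labels G A (arc_over G e))"
  "tail (und (inflate G A)) (e, x) = (tail (und G) e, x |` over G (tail (und G) e))"
  "head (und (inflate G A)) (e, x) = (head (und G) e, x |` over G (head (und G) e))"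
  "vtyp (inflate G A) (v, x) = vtyp G v"
  "etyp (inflate G A) (e, x) = etyp G e"
  by (simp_all add: inflate_def)

lemma bang_verts_inflate:
  "bang_verts (inflate G A) = (SIGMA v : bang_verts G. labels G A (over G v))"
  by (auto simp: bang_verts_def)

lemma over_subset_bang_verts: "over G v \<subseteq> bang_verts G"
  by (auto simp: over_def)

lemma over_mono:
  assumes "box_graph T G" "a \<in> over G v"
  shows "over G a \<subseteq> over G v"
  using assms(2) box_graphD(7)[OF assms(1)] by (auto simp: over_def)

lemma self_in_over:
  assumes "box_graph T G" "a \<in> bang_verts G"
  shows "a \<in> over G a"
  using assms box_graphD(5)[OF assms(1)] by (simp add: over_def)

lemma up_closed_over:
  assumes "box_graph T G"
  shows "up_closed G (over G v)"
  using over_mono[OF assms] over_subset_bang_verts[of G v] by (auto simp: up_closed_def)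

lemma up_closed_arc_over:
  assumes "box_graph T G"
  shows "up_closed G (arc_over G e)"
  using up_closed_over[OF assms, of "tail (und G) e"] up_closed_over[OF assms, of "head (und G) e"]
  unfolding up_closed_def arc_over_def by blast

text \<open>Admissibility at \<open>a\<close> looks only at \<open>over G a\<close>, which stays
  inside an up-closed \<open>W\<close>, so the restriction passes the same tests.\<close>

lemma labels_restrict:
  assumes "x \<in> labels G A U" "up_closed G W" "W \<subseteq> U"
  shows "x |` W \<in> labels G A W"
  using assms by (auto simp: labels_def up_closed_def Int_absorb1 Int_absorb2 inf_absorb2 subset_iff)

lemma wf_digraph_inflate:
  assumes "box_graph T G"
  shows "wf_digraph (und (inflate G A))"
proof
  fix e
  assume e: "e \<in> arcs (und (inflate G A))"
  interpret wf_digraph "und G" by (rule box_graphD(4)[OF assms])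
  have sub: "over G (tail (und G) (fst e)) \<subseteq> arc_over G (fst e)"
    "over G (head (und G) (fst e)) \<subseteq> arc_over G (fst e)"
    by (auto simp: arc_over_def)
  show "tail (und (inflate G A)) e \<in> verts (und (inflate G A))"
    "head (und (inflate G A)) e \<in> verts (und (inflate G A))"
    using e sub by (auto intro!: labels_restrict[OF _ up_closed_over[OF assms]])
qed

text \<open>Since \<open>a\<close> is over itself, its label is visible in the restriction that
  \<open>A\<close> tests and hence lies in \<open>N\<close>; there are only finitely many maps from
  \<open>U\<close> to \<open>N\<close>.\<close>

lemma finite_labels:
  assumes "finite U" "finite N" "\<And>a x n. A a x \<Longrightarrow> x a = Some n \<Longrightarrow> n \<in> N"
    and "\<And>a. a \<in> U \<Longrightarrow> a \<in> over G a"
  shows "finite (labels G A U)"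
proof (rule finite_subset)
  show "labels G A U \<subseteq> {x. dom x = U \<and> ran x \<subseteq> N}"
  proof
    fix x
    assume x: "x \<in> labels G A U"
    have "ran x \<subseteq> N"
    proof
      fix n
      assume "n \<in> ran x"
      then obtain a where a: "x a = Some n" by (auto simp: ran_def)
      then have "a \<in> U" "A a (x |` over G a)"
        using x by (auto simp: labels_def)
      then show "n \<in> N"
        using assms(3)[of a "x |` over G a" n] a assms(4) by simp
    qed
    then show "x \<in> {x. dom x = U \<and> ran x \<subseteq> N}"
      using x by (simp add: labels_def)
  qed
  show "finite {x. dom x = U \<and> ran x \<subseteq> N}"
    by (rule finite_set_of_finite_maps) fact+
qed

text \<open>Bounds only the label of the very vertex being tested, which already makes inflations
  finite. No graph is mentioned, so the condition can be carried from one graph to the next.\<close>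

definition fin_names :: "('v \<Rightarrow> 'v labelling \<Rightarrow> bool) \<Rightarrow> bool" where
  "fin_names A \<longleftrightarrow> finite {n. \<exists>a x. A a x \<and> x a = Some n}"

lemma finite_bang_verts_inflate:
  assumes "box_graph T G" "fin_names A"
  shows "finite (bang_verts (inflate G A))"
proof -
  have fin: "finite (bang_verts G)"
    using box_graphD(1)[OF assms(1)] by (simp add: bang_verts_def)
  show ?thesis
    unfolding bang_verts_inflate
  proof (intro finite_SigmaI fin finite_labels)
    show "finite {n. \<exists>a x. A a x \<and> x a = Some n}"
      using assms(2) by (simp add: fin_names_def)
    show "finite (over G v)" for v
      using fin over_subset_bang_verts by (rule finite_subset[rotated])
    show "a \<in> over G a" if "a \<in> over G v" for a v
      using that assms(1) over_subset_bang_verts[of G v] by (auto intro: self_in_over)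
  qed blast
qed

text \<open>Without !-vertices the empty map is the only labelling, and every predicate admits
  it.\<close>

lemma unbang_inflate_concrete:
  assumes "wf_digraph (und G)" "concrete G"
  shows "G \<simeq> unbang (inflate G A)"
proof -
  interpret wf_digraph "und G" by fact
  have [simp]: "over G v = {}" "arc_over G e = {}" "bang_verts G = {}" "labels G A {} = {Map.empty}" for v e
    using assms(2) by (auto simp: over_def arc_over_def concrete_def labels_def)
  have "is_tg_iso G (unbang (inflate G A)) (\<lambda>v. (v, Map.empty), \<lambda>e. (e, Map.empty))"
    by (auto simp: is_tg_iso_def tg_hom_def graph_hom_def unbang_def remove_verts_def
        bang_verts_inflate bij_betw_def inj_on_def restrict_map_def)
  then show ?thesis unfolding tg_iso_iff by blast
qed

subsection \<open>Deleting and dropping a !-vertex\<close>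

text \<open>Any labelling of an up-closed set containing \<open>b\<close> would restrict to one of
  \<open>over G b\<close>. So nothing in the box of \<open>b\<close> has a copy, while outside the
  box the boxes over a vertex are unchanged. The isomorphism is the identity.\<close>

lemma inflate_kill:
  assumes G: "box_graph T G" and b: "b \<in> bang_verts G"
    and empty: "labels G A (over G b) = {}"
    and A: "\<And>a x. (b, a) \<notin> arcs_ends (und G) \<Longrightarrow> A a x \<longleftrightarrow> A' a x"
  shows "inflate G A \<simeq> inflate (kill_bang b G) A'"
proof -
  interpret wf_digraph "und G" by (rule box_graphD(4)[OF G])
  let ?K = "kill_bang b G"
  let ?B = "{v. (b, v) \<in> arcs_ends (und G)}"
  have K: "?K = full_sub G (- ?B)"
    by (simp add: kill_bang_def remove_verts_def verts_bang_box[OF G])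
  \<comment> \<open>By transitivity, a box over a vertex outside the box of \<open>b\<close> is
    itself outside it.\<close>
  have disj: "over G v \<inter> ?B = {}" if "v \<notin> ?B" for v
    using that b box_graphD(7)[OF G, of b] by (auto simp: over_def)
  have over_K: "over ?K v = over G v" if "v \<notin> ?B" for v
    using disj[OF that] that box_graphD(4)[OF G]
    by (auto simp: K over_def arcs_ends_full_sub)
  have nolab: "labels G A U = {}" if "up_closed G U" "b \<in> U" for U
  proof (rule ccontr)
    assume "labels G A U \<noteq> {}"
    then obtain x where "x \<in> labels G A U" by blast
    then have "x |` over G b \<in> labels G A (over G b)"
      using that by (intro labels_restrict up_closed_over[OF G]) (auto simp: up_closed_def)
    then show False using empty by simp
  qed
  have lab: "labels G A U = labels ?K A' U" if "U \<inter> ?B = {}" for U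
  proof -
    have "A a (x |` over G a) \<longleftrightarrow> A' a (x |` over ?K a)" if "a \<in> U" for a x
    proof -
      have "(b, a) \<notin> arcs_ends (und G)"
        using that \<open>U \<inter> ?B = {}\<close> by blast
      then show ?thesis by (simp add: A over_K)
    qed
    then show ?thesis by (simp add: labels_def cong: conj_cong)
  qed
  have inB: "b \<in> over G v" if "v \<in> ?B" for v
    using that b by (simp add: over_def)
  have V: "verts (und (inflate G A)) = verts (und (inflate ?K A'))"
  proof -
    have "labels G A (over G v) = (if v \<in> ?B then {} else labels ?K A' (over ?K v))" for v
    proof (cases "v \<in> ?B")
      case True
      then show ?thesis using nolab[OF up_closed_over[OF G] inB] by simp
    next
      case False
      then show ?thesis using lab[OF disj] over_K by simp
    qed
    then show ?thesis by (auto simp: K split: if_splits)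
  qed
  have AR: "arcs (und (inflate G A)) = arcs (und (inflate ?K A'))"
  proof -
    have "labels G A (arc_over G e) =
      (if tail (und G) e \<in> ?B \<or> head (und G) e \<in> ?B then {} else labels ?K A' (arc_over ?K e))" for e
    proof (cases "tail (und G) e \<in> ?B \<or> head (und G) e \<in> ?B")
      case True
      then have "b \<in> arc_over G e" using inB by (auto simp: arc_over_def)
      then show ?thesis using True nolab[OF up_closed_arc_over[OF G]] by simp
    next
      case False
      then have "arc_over ?K e = arc_over G e" "arc_over G e \<inter> ?B = {}"
        using over_K disj by (auto simp: arc_over_def K)
      then show ?thesis using lab False by simp
    qed
    then show ?thesis by (auto simp: K split: if_splits)
  qed
  have "is_tg_iso (inflate G A) (inflate ?K A') (id, id)"
    unfolding is_tg_iso_def tg_hom_def graph_hom_def using V AR over_K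
    by (auto simp: K)
  then show ?thesis unfolding tg_iso_iff by blast
qed

lemma bij_betw_Sigma_snd:
  assumes "\<And>i. i \<in> I \<Longrightarrow> bij_betw f (M i) (N i)"
  shows "bij_betw (\<lambda>(i, x). (i, f x)) (Sigma I M) (Sigma I N)"
proof (rule bij_betw_imageI)
  show "inj_on (\<lambda>(i, x). (i, f x)) (Sigma I M)"
    using assms by (auto simp: bij_betw_def inj_on_def)
  have "(\<lambda>(i, x). (i, f x)) ` Sigma I M = (SIGMA i : I. f ` M i)" by auto
  also have "\<dots> = Sigma I N"
    using assms by (intro Sigma_cong) (auto simp: bij_betw_def)
  finally show "(\<lambda>(i, x). (i, f x)) ` Sigma I M = Sigma I N" .
qed

text \<open>Once the label of \<open>b\<close> is forced to be \<open>n\<close>, forgetting it is a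
  bijection on labellings. What remains of \<open>b\<close> are the copies of the vertex itself,
  which are removed on the left. This serves both for DROP and for the drop inside EXP.\<close>

lemma inflate_drop:
  fixes G :: "('v, 'e, 'o, 'm) tgraph"
  assumes G: "box_graph T G" and b: "b \<in> bang_verts G"
    and Ab: "\<And>x. dom x = over G b \<Longrightarrow> A b x \<longleftrightarrow> x b = Some n"
    and A: "\<And>a x. a \<in> bang_verts G \<Longrightarrow> a \<noteq> b \<Longrightarrow> dom x = over G a \<Longrightarrow>
      (b \<in> over G a \<Longrightarrow> x b = Some n) \<Longrightarrow> A a x \<longleftrightarrow> A' a (x |` (- {b}))"
  shows "remove_verts (inflate G A) {v. fst v = b} \<simeq> inflate (drop_bang b G) A'"
proof -
  interpret wf_digraph "und G" by (rule box_graphD(4)[OF G])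
  let ?D = "drop_bang b G"
  have D: "?D = full_sub G (- {b})"
    by (simp add: drop_bang_def remove_verts_def)
  have over_D: "over ?D v = over G v - {b}" if "v \<noteq> b" for v
    using that by (auto simp: D over_def arcs_ends_full_sub[OF box_graphD(4)[OF G]])
  let ?f = "\<lambda>x :: 'v labelling. x |` (- {b})"
  have val: "x b = Some n" if "x \<in> labels G A U" "up_closed G U" "b \<in> U" for x U
  proof -
    have "A b (x |` over G b)" "dom (x |` over G b) = over G b"
      using that by (auto simp: labels_def up_closed_def)
    then have "(x |` over G b) b = Some n" using Ab by simp
    then show ?thesis by (simp add: restrict_map_def split: if_splits)
  qed
  have A_iff: "A a (x |` over G a) \<longleftrightarrow> A' a (?f x |` over ?D a)"
    if "up_closed G U" "a \<in> U" "a \<noteq> b" "dom x = U" "b \<in> U \<Longrightarrow> x b = Some n" for a x U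
  proof -
    have sub: "a \<in> bang_verts G" "over G a \<subseteq> U"
      using that by (auto simp: up_closed_def)
    have "A a (x |` over G a) \<longleftrightarrow> A' a (?f (x |` over G a))"
      using that sub by (intro A) auto
    also have "?f (x |` over G a) = ?f x |` over ?D a"
      using that(3) by (auto simp: over_D restrict_map_def)
    finally show ?thesis .
  qed
  have bij: "bij_betw ?f (labels G A U) (labels ?D A' (U - {b}))" if U: "up_closed G U" for U
  proof (rule bij_betw_imageI)
    show "inj_on ?f (labels G A U)"
    proof (rule inj_onI)
      fix x y
      assume xy: "x \<in> labels G A U" "y \<in> labels G A U" "?f x = ?f y"
      show "x = y"
      proof
        fix a
        show "x a = y a"
        proof (cases "a = b")
          case True
          show ?thesis
          proof (cases "b \<in> U")
            case in_U: True
            then show ?thesis using True val[OF xy(1) U] val[OF xy(2) U] by simp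
          next
            case False
            then have "b \<notin> dom x" "b \<notin> dom y" using xy by (auto simp: labels_def)
            then show ?thesis using True by (auto simp: domIff)
          qed
        next
          case False
          then show ?thesis using fun_cong[OF xy(3), of a] by simp
        qed
      qed
    qed
    show "?f ` labels G A U = labels ?D A' (U - {b})"
    proof (intro equalityI subsetI)
      fix y
      assume "y \<in> ?f ` labels G A U"
      then obtain x where x: "x \<in> labels G A U" "y = ?f x" by blast
      then have "A' a (?f x |` over ?D a)" if "a \<in> U - {b}" for a
        using that A_iff[OF U, of a x] val[OF _ U] by (auto simp: labels_def)
      then show "y \<in> labels ?D A' (U - {b})"
        using x by (auto simp: labels_def)
    next
      fix y
      assume y: "y \<in> labels ?D A' (U - {b})"
      \<comment> \<open>The inverse of forgetting: the forced label is put back wherever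
        \<open>b\<close> has to be labelled.\<close>
      define x where "x = (if b \<in> U then y(b \<mapsto> n) else y)"
      have dom_y: "dom y = U - {b}" using y by (simp add: labels_def)
      then have "y b = None" by (auto simp: domIff)
      then have dom_x: "dom x = U" and xb: "b \<in> U \<Longrightarrow> x b = Some n" and fx: "?f x = y"
        using dom_y by (auto simp: x_def restrict_map_def fun_eq_iff)
      have "A a (x |` over G a)" if "a \<in> U" for a
      proof (cases "a = b")
        case True
        have "dom (x |` over G b) = over G b" "b \<in> over G b"
          using that True U dom_x b by (auto simp: up_closed_def self_in_over[OF G])
        then show ?thesis
          using True xb that by (simp add: Ab)
      next
        case False
        then have "A' a (?f x |` over ?D a)"
          using y that by (simp add: fx labels_def)
        then show ?thesis
          using A_iff[OF U that False dom_x xb] by simp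
      qed
      then have "x \<in> labels G A U" using dom_x by (simp add: labels_def)
      then show "y \<in> ?f ` labels G A U" using fx by blast
    qed
  qed
  let ?R = "remove_verts (inflate G A) {v. fst v = b}"
  have R_verts: "verts (und ?R) = (SIGMA v : verts (und G) - {b}. labels G A (over G v))"
    by (auto simp: remove_verts_def)
  have R_arcs: "arcs (und ?R) =
      (SIGMA e : arcs (und ?D). labels G A (arc_over G e))"
    using wf_digraph.tail_in_verts[OF wf_digraph_inflate[OF G, of A]]
      wf_digraph.head_in_verts[OF wf_digraph_inflate[OF G, of A]]
    by (fastforce simp: remove_verts_def D)
  have arc_D: "arc_over ?D e = arc_over G e - {b}" if "e \<in> arcs (und ?D)" for e
    using that by (auto simp: arc_over_def D over_D[unfolded D])
  have restr: "- {b} \<inter> over ?D v = over G v \<inter> - {b}" if "v \<noteq> b" for v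
    using that by (auto simp: over_D)
  have "bij_betw (\<lambda>(v, x). (v, ?f x)) (verts (und ?R)) (verts (und (inflate ?D A')))"
  proof -
    have "verts (und (inflate ?D A')) = (SIGMA v : verts (und G) - {b}. labels ?D A' (over G v - {b}))"
      by (auto simp: D over_D[unfolded D])
    then show ?thesis
      unfolding R_verts by (simp only:) (intro bij_betw_Sigma_snd bij up_closed_over[OF G])
  qed
  moreover have "bij_betw (\<lambda>(v, x). (v, ?f x)) (arcs (und ?R)) (arcs (und (inflate ?D A')))"
    unfolding R_arcs inflate_simps
    using arc_D by (intro bij_betw_Sigma_snd) (simp add: bij up_closed_arc_over[OF G])
  moreover have "tg_hom ?R (inflate ?D A') (\<lambda>(v, x). (v, ?f x), \<lambda>(v, x). (v, ?f x))"
  proof -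
    have 1: "tail (und ?R) = tail (und (inflate G A))" "head (und ?R) = head (und (inflate G A))"
       "vtyp ?R = vtyp (inflate G A)" "etyp ?R = etyp (inflate G A)"
       "tail (und ?D) = tail (und G)" "head (und ?D) = head (und G)" "vtyp ?D = vtyp G" "etyp ?D = etyp G"
      by (simp_all add: remove_verts_def D)
    have "tail (und G) e \<noteq> b" "head (und G) e \<noteq> b" if "e \<in> arcs (und ?D)" for e
      using that by (auto simp: D)
    then show ?thesis
      using calculation bij_betwE[OF calculation(1)] bij_betwE[OF calculation(2)]
      unfolding tg_hom_def graph_hom_def
      by (auto simp: 1 R_arcs restr simp del: inflate_simps(1,2))
  qed
  ultimately show ?thesis
    unfolding tg_iso_iff is_tg_iso_def by (intro exI conjI) (assumption | simp)+
qed

subsection \<open>Copying a box\<close>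

text \<open>An elementwise description of the pushout defining COPY; \<open>pr i\<close> and \<open>pe i\<close> are the vertex and edge
  parts of the two coprojections.\<close>

locale box_copy =
  fixes T :: "('o, 'm) signature" and G :: "('v, 'e, 'o, 'm) tgraph" and b :: 'v
    and P :: "('v, 'e, 'o, 'm) tgraph" and pr :: "bool \<Rightarrow> 'v \<Rightarrow> 'v" and pe :: "bool \<Rightarrow> 'e \<Rightarrow> 'e"
  assumes box_graph: "box_graph T G" and bang: "b \<in> bang_verts G"
    and typed: "typed_over (bang_typegraph T) P"
    and hom: "tg_hom G P (pr i, pe i)"
    and pr_eq_iff: "v \<in> verts (und G) \<Longrightarrow> w \<in> verts (und G) \<Longrightarrow>
      pr i v = pr j w \<longleftrightarrow> v = w \<and> (i = j \<or> (b, v) \<notin> arcs_ends (und G))"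
    and pe_eq_iff: "e \<in> arcs (und G) \<Longrightarrow> d \<in> arcs (und G) \<Longrightarrow>
      pe i e = pe j d \<longleftrightarrow> e = d \<and>
        (i = j \<or> (b, tail (und G) e) \<notin> arcs_ends (und G) \<and> (b, head (und G) e) \<notin> arcs_ends (und G))"
    and verts_P: "verts (und P) = (\<Union>i. pr i ` verts (und G))"
    and arcs_P: "arcs (und P) = (\<Union>i. pe i ` arcs (und G))"
begin

section \<open>Order and boxes in the copied graph\<close>

sublocale G: wf_digraph "und G" by (rule box_graphD(4)[OF box_graph])

lemma pe_simps:
  assumes "e \<in> arcs (und G)"
  shows "pe i e \<in> arcs (und P)"
    "tail (und P) (pe i e) = pr i (tail (und G) e)" "head (und P) (pe i e) = pr i (head (und G) e)"
    "etyp P (pe i e) = etyp G e"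
  using hom[of i] assms by (auto simp: tg_hom_def graph_hom_def)

lemma pr_simps:
  assumes "v \<in> verts (und G)"
  shows "pr i v \<in> verts (und P)" "vtyp P (pr i v) = vtyp G v"
  using hom[of i] assms by (auto simp: tg_hom_def graph_hom_def)

lemma bang_verts_P: "bang_verts P = (\<Union>i. pr i ` bang_verts G)"
  by (auto simp: bang_verts_def verts_P pr_simps) blast

lemma ends_in_verts:
  assumes "(u, v) \<in> arcs_ends (und G)"
  shows "u \<in> verts (und G)" "v \<in> verts (und G)"
  using assms by (auto simp: arcs_ends_conv)

lemma in_arcs_ends_P:
  "(x, y) \<in> arcs_ends (und P) \<longleftrightarrow>
    (\<exists>i u v. (u, v) \<in> arcs_ends (und G) \<and> x = pr i u \<and> y = pr i v)"
  unfolding arcs_ends_conv arcs_P by (force simp: pe_simps image_iff)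

text \<open>Used throughout for gluing: a !-vertex whose box contains a shared vertex is itself
  shared by the two copies of \<open>G\<close>.\<close>

lemma pred_outside_box:
  assumes "a \<in> bang_verts G" "(a, v) \<in> arcs_ends (und G)" "(b, v) \<notin> arcs_ends (und G)"
  shows "(b, a) \<notin> arcs_ends (und G)"
  using assms box_graphD(7)[OF box_graph bang assms(1)] by blast

text \<open>Every arc of \<open>P\<close> comes from one of two copies of \<open>G\<close>. If two
  composable arcs come from different copies, they meet outside the box of \<open>b\<close>; then
  the source of the first is shared too, and both arcs can be read in the same copy.\<close>

lemma box_graph_P: "box_graph T P"
  unfolding box_graph_def
proof (intro conjI ballI allI impI)
  show "finite (verts (und P))" "finite (arcs (und P))" "typed_over (bang_typegraph T) P"
    using box_graphD(1,2)[OF box_graph] typed by (simp_all add: verts_P arcs_P)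
  show "(x, x) \<in> arcs_ends (und P)" if "x \<in> bang_verts P" for x
    using that box_graphD(5)[OF box_graph] by (auto simp: bang_verts_P in_arcs_ends_P)
  show "x = y" if xy: "x \<in> bang_verts P" "y \<in> bang_verts P" "(x, y) \<in> arcs_ends (und P)"
      "(y, x) \<in> arcs_ends (und P)" for x y
  proof -
    obtain i u v where uv: "(u, v) \<in> arcs_ends (und G)" "x = pr i u" "y = pr i v"
      using xy(3) by (auto simp: in_arcs_ends_P)
    obtain j u' v' where uv': "(v', u') \<in> arcs_ends (und G)" "y = pr j v'" "x = pr j u'"
      using xy(4) by (auto simp: in_arcs_ends_P)
    have "u' = u" "v' = v"
      using uv uv' pr_eq_iff[of u u' i j] pr_eq_iff[of v v' i j] by (auto dest: ends_in_verts)
    moreover have "u \<in> bang_verts G" "v \<in> bang_verts G"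
      using uv xy ends_in_verts[OF uv(1)] by (auto simp: bang_verts_def pr_simps)
    ultimately show ?thesis
      using uv uv' box_graphD(6)[OF box_graph, of u v] by simp
  qed
  show "(x, z) \<in> arcs_ends (und P)"
    if xyz: "x \<in> bang_verts P" "y \<in> bang_verts P" "(x, y) \<in> arcs_ends (und P)"
      "(y, z) \<in> arcs_ends (und P)" for x y z
  proof -
    obtain i u v where uv: "(u, v) \<in> arcs_ends (und G)" "x = pr i u" "y = pr i v"
      using xyz(3) by (auto simp: in_arcs_ends_P)
    obtain j v' w where vw: "(v', w) \<in> arcs_ends (und G)" "y = pr j v'" "z = pr j w"
      using xyz(4) by (auto simp: in_arcs_ends_P)
    have v: "v' = v" "i = j \<or> (b, v) \<notin> arcs_ends (und G)"
      using uv vw pr_eq_iff[of v v' i j] by (auto dest: ends_in_verts)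
    have bangs: "u \<in> bang_verts G" "v \<in> bang_verts G"
      using uv xyz ends_in_verts[OF uv(1)] by (auto simp: bang_verts_def pr_simps)
    have "x = pr j u"
      using v(2) uv pred_outside_box[OF bangs(1) uv(1)] pr_eq_iff[of u u i j] ends_in_verts[OF uv(1)]
      by auto
    moreover have "(u, w) \<in> arcs_ends (und G)"
      using box_graphD(7)[OF box_graph bangs uv(1)] vw v by simp
    ultimately show ?thesis
      using vw by (auto simp: in_arcs_ends_P)
  qed
qed

lemma over_subset_verts: "over G v \<subseteq> verts (und G)"
  by (auto simp: over_def bang_verts_def)

lemma pr_outside_box:
  assumes "v \<in> verts (und G)" "b \<notin> over G v"
  shows "pr i v = pr j v"
  using assms pr_eq_iff[of v v i j] bang by (auto simp: over_def)

text \<open>A predecessor coming from the other copy forces \<open>v\<close> to be outside the box;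
  then the predecessor is shared and also comes from copy \<open>i\<close>.\<close>

lemma over_pr:
  assumes "v \<in> verts (und G)"
  shows "over P (pr i v) = pr i ` over G v"
proof (intro equalityI subsetI)
  fix x
  assume "x \<in> pr i ` over G v"
  then show "x \<in> over P (pr i v)"
    by (auto simp: over_def bang_verts_P in_arcs_ends_P)
next
  fix x
  assume "x \<in> over P (pr i v)"
  then obtain j a w where aw: "(a, w) \<in> arcs_ends (und G)" "x = pr j a" "pr i v = pr j w"
      and x: "x \<in> bang_verts P"
    by (auto simp: over_def in_arcs_ends_P)
  note verts = ends_in_verts[OF aw(1)]
  have a: "a \<in> bang_verts G"
    using x aw verts by (auto simp: bang_verts_def pr_simps)
  have w: "w = v" "i = j \<or> (b, v) \<notin> arcs_ends (und G)"
    using aw pr_eq_iff[OF assms verts(2), of i j] by auto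
  then have "x = pr i a"
    using aw verts pred_outside_box[OF a aw(1)] pr_eq_iff[of a a i j] by auto
  then show "x \<in> pr i ` over G v"
    using a aw w by (auto simp: over_def)
qed

lemma arc_over_pe:
  assumes "e \<in> arcs (und G)"
  shows "arc_over P (pe i e) = pr i ` arc_over G e"
  using assms by (auto simp: arc_over_def pe_simps over_pr)

lemma up_closed_subset_verts:
  assumes "up_closed G U"
  shows "U \<subseteq> verts (und G)"
  using assms by (auto simp: up_closed_def bang_verts_def)

lemma pr_image_outside_box:
  assumes "up_closed G U" "b \<notin> U" "a \<in> U"
  shows "pr i a = pr j a"
  using assms up_closed_subset_verts[OF assms(1)] by (intro pr_outside_box) (auto simp: up_closed_def)

section \<open>Transport of labellings to the copied graph\<close>

text \<open>On vertices of \<open>P\<close> this is the codiagonal, folding the two copies back onto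
  \<open>G\<close>.\<close>

definition proj :: "'v \<Rightarrow> 'v" where
  "proj x = (SOME v. v \<in> verts (und G) \<and> (\<exists>i. x = pr i v))"

lemma proj_pr:
  assumes "v \<in> verts (und G)"
  shows "proj (pr i v) = v"
  unfolding proj_def using assms by (intro some_equality) (auto simp: pr_eq_iff)

text \<open>A label \<open>n\<close> of \<open>b\<close> encodes the pair \<open>(\<sigma> n, \<nu> n)\<close>: \<open>\<sigma> n\<close> says to which of the two copies of \<open>b\<close> in
  the pushout it belongs, and \<open>\<nu> n\<close> is its label there. All other labels are kept.\<close>

definition side :: "(nat \<Rightarrow> bool) \<Rightarrow> 'v labelling \<Rightarrow> bool" where
  "side \<sigma> x = (case x b of None \<Rightarrow> False | Some n \<Rightarrow> \<sigma> n)"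

definition transport :: "(nat \<Rightarrow> bool) \<Rightarrow> (nat \<Rightarrow> nat) \<Rightarrow> 'v labelling \<Rightarrow> 'v labelling" where
  "transport \<sigma> \<nu> x = (\<lambda>a'. if a' \<in> pr (side \<sigma> x) ` dom x
     then (x(b := map_option \<nu> (x b))) (proj a') else None)"

lemma transport_pr:
  assumes "a \<in> verts (und G)" "dom x \<subseteq> verts (und G)"
  shows "transport \<sigma> \<nu> x (pr (side \<sigma> x) a) = (x(b := map_option \<nu> (x b))) a"
proof (cases "a \<in> dom x")
  case True
  then show ?thesis
    using assms by (auto simp: transport_def proj_pr)
next
  case False
  then have "pr (side \<sigma> x) a \<notin> pr (side \<sigma> x) ` dom x"
    using assms pr_eq_iff[OF assms(1), of _ "side \<sigma> x" "side \<sigma> x"] by blast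
  then show ?thesis
    using False by (auto simp: transport_def domIff)
qed

lemma dom_transport:
  assumes "dom x \<subseteq> verts (und G)"
  shows "dom (transport \<sigma> \<nu> x) = pr (side \<sigma> x) ` dom x"
proof (intro equalityI subsetI)
  fix a'
  assume "a' \<in> dom (transport \<sigma> \<nu> x)"
  then show "a' \<in> pr (side \<sigma> x) ` dom x"
    by (auto simp: transport_def split: if_splits)
next
  fix a'
  assume "a' \<in> pr (side \<sigma> x) ` dom x"
  then obtain a n where "a' = pr (side \<sigma> x) a" "x a = Some n" by auto
  then show "a' \<in> dom (transport \<sigma> \<nu> x)"
    using transport_pr[of a x \<sigma> \<nu>] assms by (auto simp: domIff subset_iff)
qed

text \<open>Labels other than that of \<open>b\<close> are kept, and the label of \<open>b\<close>
  is recovered from its side and its transported value by injectivity of the coding.\<close>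

lemma transport_inj:
  assumes inj: "inj (\<lambda>n. (\<sigma> n, \<nu> n))"
    and dom: "dom x \<subseteq> verts (und G)" "dom y = dom x" and side: "side \<sigma> x = side \<sigma> y"
    and eq: "transport \<sigma> \<nu> x = transport \<sigma> \<nu> y"
  shows "x = y"
proof
  fix a
  show "x a = y a"
  proof (cases "a \<in> dom x")
    case False
    then show ?thesis using dom by (metis domIff)
  next
    case True
    then have "a \<in> verts (und G)" using dom by blast
    then have "(x(b := map_option \<nu> (x b))) a = (y(b := map_option \<nu> (y b))) a"
      using transport_pr[of a x \<sigma> \<nu>] transport_pr[of a y \<sigma> \<nu>] dom eq side by simp
    note eq_a = this
    show ?thesis
    proof (cases "a = b")
      case False
      then show ?thesis using eq_a by simp
    next
      case b: True
      then have "b \<in> dom x" "b \<in> dom y" using True dom(2) by simp_all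
      then obtain n k where nk: "x b = Some n" "y b = Some k" by blast
      have "\<sigma> n = \<sigma> k" "\<nu> n = \<nu> k"
        using side eq_a b nk by (simp_all add: side_def)
      then have "n = k" using inj by (simp add: inj_def)
      then show ?thesis using b nk by simp
    qed
  qed
qed

lemma side_restrict:
  assumes "b \<in> W"
  shows "side \<sigma> (x |` W) = side \<sigma> x"
  using assms by (simp add: side_def)

text \<open>If \<open>b\<close> is not in \<open>W\<close>, restriction resets \<open>side\<close>
  to its default. This does no harm: an up-closed \<open>W\<close> without \<open>b\<close> lies
  outside the box, where the two coprojections agree.\<close>

lemma transport_restrict:
  assumes "up_closed G U" "dom x = U" "up_closed G W" "W \<subseteq> U"
  shows "transport \<sigma> \<nu> (x |` W) = transport \<sigma> \<nu> x |` (pr (side \<sigma> x) ` W)"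
proof -
  let ?i = "side \<sigma> x"
  have pr_W: "pr (side \<sigma> (x |` W)) a = pr ?i a" if "a \<in> W" for a
    using that pr_image_outside_box[OF assms(3)] by (cases "b \<in> W") (auto simp: side_restrict)
  have verts: "W \<subseteq> verts (und G)" "dom x \<subseteq> verts (und G)" "dom (x |` W) = W"
    using assms up_closed_subset_verts by auto
  show ?thesis
  proof
    fix a'
    show "transport \<sigma> \<nu> (x |` W) a' = (transport \<sigma> \<nu> x |` (pr ?i ` W)) a'"
    proof (cases "a' \<in> pr ?i ` W")
      case True
      then obtain a where a: "a \<in> W" "a' = pr ?i a" by blast
      then have "transport \<sigma> \<nu> (x |` W) a' = ((x |` W)(b := map_option \<nu> ((x |` W) b))) a"
        using transport_pr[of a "x |` W" \<sigma> \<nu>] verts pr_W[of a] by auto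
      also have "\<dots> = (x(b := map_option \<nu> (x b))) a"
        using a by auto
      also have "\<dots> = transport \<sigma> \<nu> x a'"
        using transport_pr[of a x \<sigma> \<nu>] verts a by auto
      finally show ?thesis using True by simp
    next
      case False
      then have "a' \<notin> dom (transport \<sigma> \<nu> (x |` W))"
        using dom_transport[of "x |` W" \<sigma> \<nu>] verts pr_W by auto
      then show ?thesis using False by (simp add: domIff)
    qed
  qed
qed

lemma pr_side_restrict:
  assumes "v \<in> verts (und G)"
  shows "pr (side \<sigma> (x |` over G v)) v = pr (side \<sigma> x) v"
  using pr_outside_box[OF assms] by (cases "b \<in> over G v") (auto simp: side_restrict)


text \<open>The assumption compares \<open>A\<close> and \<open>A'\<close> on the boxes over a
  single !-vertex. It extends to all of \<open>U\<close> because transport commutes with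
  restriction.\<close>

lemma transport_in_labels_iff:
  assumes A: "\<And>a x. a \<in> bang_verts G \<Longrightarrow> dom x = over G a \<Longrightarrow>
      A a x \<longleftrightarrow> A' (pr (side \<sigma> x) a) (transport \<sigma> \<nu> x)"
    and U: "up_closed G U" and dom: "dom x = U"
  shows "x \<in> labels G A U \<longleftrightarrow> transport \<sigma> \<nu> x \<in> labels P A' (pr (side \<sigma> x) ` U)"
proof -
  let ?i = "side \<sigma> x"
  have "A a (x |` over G a) \<longleftrightarrow> A' (pr ?i a) (transport \<sigma> \<nu> x |` over P (pr ?i a))"
    if "a \<in> U" for a
  proof -
    have a: "a \<in> bang_verts G" "a \<in> verts (und G)" "over G a \<subseteq> U"
      using that U by (auto simp: up_closed_def bang_verts_def)
    then have "A a (x |` over G a) \<longleftrightarrow>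
        A' (pr (side \<sigma> (x |` over G a)) a) (transport \<sigma> \<nu> (x |` over G a))"
      using dom by (intro A) auto
    then show ?thesis
      by (simp add: pr_side_restrict a over_pr
          transport_restrict[OF U dom up_closed_over[OF box_graph] a(3)])
  qed
  moreover have "dom (transport \<sigma> \<nu> x) = pr ?i ` U"
    using dom up_closed_subset_verts[OF U] by (simp add: dom_transport)
  ultimately show ?thesis
    using dom by (auto simp: labels_def)
qed

text \<open>Pull \<open>y\<close> back along \<open>pr i\<close>, then replace the label at
  \<open>b\<close> by a code \<open>n\<close> of the pair of \<open>i\<close> and that label. The
  side is controlled only if \<open>b\<close> is labelled; otherwise it has its default
  value.\<close>

lemma transport_surj:
  assumes surj: "\<And>y i. dom y = over P (pr i b) \<Longrightarrow> A' (pr i b) y \<Longrightarrow>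
      \<exists>n. \<sigma> n = i \<and> y (pr i b) = Some (\<nu> n)"
    and U: "up_closed G U" and y: "y \<in> labels P A' (pr i ` U)"
  obtains x where "dom x = U" "transport \<sigma> \<nu> x = y" "b \<in> U \<Longrightarrow> side \<sigma> x = i"
proof -
  have verts: "U \<subseteq> verts (und G)" by (rule up_closed_subset_verts[OF U])
  have dom_y: "dom y = pr i ` U" using y by (simp add: labels_def)
  define z where "z = (\<lambda>a. if a \<in> U then y (pr i a) else None)"
  have dom_z: "dom z = U" using dom_y by (fastforce simp: z_def domIff split: if_splits)
  obtain x where x: "dom x = U" "x(b := map_option \<nu> (x b)) = z" "b \<in> U \<Longrightarrow> side \<sigma> x = i"
  proof (cases "b \<in> U")
    case True
    then have b: "b \<in> verts (und G)" "over G b \<subseteq> U" "pr i b \<in> over P (pr i b)"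
      using verts U bang by (auto simp: over_pr up_closed_def self_in_over[OF box_graph])
    have "A' (pr i b) (y |` over P (pr i b))"
      using True y by (simp add: labels_def)
    moreover have "dom (y |` over P (pr i b)) = over P (pr i b)"
      using b dom_y by (auto simp: over_pr)
    ultimately obtain n where "\<sigma> n = i" "(y |` over P (pr i b)) (pr i b) = Some (\<nu> n)"
      using surj by blast
    then have n: "\<sigma> n = i" "z b = Some (\<nu> n)"
      using b True by (auto simp: z_def)
    show ?thesis
    proof (rule that)
      show "dom (z(b \<mapsto> n)) = U" using dom_z True by auto
      show "(z(b \<mapsto> n))(b := map_option \<nu> ((z(b \<mapsto> n)) b)) = z" using n by auto
      show "side \<sigma> (z(b \<mapsto> n)) = i" using n by (simp add: side_def)
    qed
  next
    case False
    then have "z b = None" by (simp add: z_def)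
    then show ?thesis using that[of z] False dom_z by auto
  qed
  have pr_U: "pr (side \<sigma> x) a = pr i a" if "a \<in> U" for a
    using that x(3) pr_image_outside_box[OF U] by (cases "b \<in> U") auto
  have "transport \<sigma> \<nu> x a' = y a'" for a'
  proof (cases "a' \<in> pr i ` U")
    case True
    then obtain a where "a \<in> U" "a' = pr i a" by blast
    then show ?thesis
      using transport_pr[of a x \<sigma> \<nu>] x verts pr_U[of a] by (auto simp: z_def)
  next
    case False
    then have "a' \<notin> dom (transport \<sigma> \<nu> x)" "a' \<notin> dom y"
      using dom_transport[of x \<sigma> \<nu>] x verts pr_U dom_y by auto
    then show ?thesis by (simp add: domIff)
  qed
  then show thesis using that x by blast
qed

text \<open>If \<open>b\<close> is over \<open>v\<close>, the vertex of \<open>P\<close> reveals the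
  side. If not, both labellings leave \<open>b\<close> unlabelled and both sides take the default
  value.\<close>

lemma transport_determines:
  assumes inj: "inj (\<lambda>n. (\<sigma> n, \<nu> n))"
    and v: "v \<in> verts (und G)" "dom x = over G v" and w: "w \<in> verts (und G)" "dom y = over G w"
    and eq: "pr (side \<sigma> x) v = pr (side \<sigma> y) w" "transport \<sigma> \<nu> x = transport \<sigma> \<nu> y"
  shows "v = w" "x = y"
proof -
  have vw: "v = w" "side \<sigma> x = side \<sigma> y \<or> (b, v) \<notin> arcs_ends (und G)"
    using pr_eq_iff[OF v(1) w(1)] eq by auto
  have "side \<sigma> x = side \<sigma> y"
  proof (cases "b \<in> over G v")
    case True
    then show ?thesis using vw by (simp add: over_def)
  next
    case False
    then have "x b = None" "y b = None" using v w vw by auto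
    then show ?thesis by (simp add: side_def)
  qed
  then show "x = y"
    using transport_inj[OF inj, of x y] eq vw v w over_subset_verts by simp
  show "v = w" by fact
qed

text \<open>The isomorphism moves an element along the coprojection chosen by \<open>side\<close>
  and transports its labelling. The coding stays abstract because two are used: parity for undoing
  COPY, and comparison with one fixed label for EXP.\<close>

lemma inflate_copy:
  assumes inj: "inj (\<lambda>n. (\<sigma> n, \<nu> n))"
    and A: "\<And>a x. a \<in> bang_verts G \<Longrightarrow> dom x = over G a \<Longrightarrow>
      A a x \<longleftrightarrow> A' (pr (side \<sigma> x) a) (transport \<sigma> \<nu> x)"
    and surj: "\<And>y i. dom y = over P (pr i b) \<Longrightarrow> A' (pr i b) y \<Longrightarrow>
      \<exists>n. \<sigma> n = i \<and> y (pr i b) = Some (\<nu> n)"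
  shows "inflate G A \<simeq> inflate P A'"
proof -
  let ?s = "side \<sigma>" and ?t = "transport \<sigma> \<nu>"
  have lab: "x \<in> labels G A U \<longleftrightarrow> ?t x \<in> labels P A' (pr (?s x) ` U)"
    if "up_closed G U" "dom x = U" for x U
    using A that by (rule transport_in_labels_iff)
  have surjE: "\<exists>x. dom x = U \<and> ?t x = y \<and> (b \<in> U \<longrightarrow> ?s x = i)"
    if "up_closed G U" "y \<in> labels P A' (pr i ` U)" for y U i
    by (rule transport_surj[where \<sigma> = \<sigma> and \<nu> = \<nu>, OF _ that, rotated]) (use surj in blast)+
  note up_v = up_closed_over[OF box_graph] and up_e = up_closed_arc_over[OF box_graph]
  have labD: "dom x = U" "dom x \<subseteq> verts (und G)" if "x \<in> labels G A U" "up_closed G U" for x U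
    using that up_closed_subset_verts by (auto simp: labels_def)
  have bv: "bij_betw (\<lambda>(v, x). (pr (?s x) v, ?t x)) (verts (und (inflate G A)))
      (verts (und (inflate P A')))"
    (is "bij_betw ?f _ _")
  proof (rule bij_betw_imageI)
    show "inj_on ?f (verts (und (inflate G A)))"
    proof (rule inj_onI, clarify)
      fix v x w y
      assume *: "(v, x) \<in> verts (und (inflate G A))" "(w, y) \<in> verts (und (inflate G A))"
        and eq: "pr (?s x) v = pr (?s y) w" "?t x = ?t y"
      then show "v = w \<and> x = y"
        using transport_determines[OF inj _ labD(1)[OF _ up_v] _ labD(1)[OF _ up_v]] by auto
    qed
    show "?f ` verts (und (inflate G A)) = verts (und (inflate P A'))"
    proof (intro equalityI subsetI)
      fix u
      assume "u \<in> ?f ` verts (und (inflate G A))"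
      then obtain v x where "v \<in> verts (und G)" "x \<in> labels G A (over G v)"
          "u = (pr (?s x) v, ?t x)"
        by auto
      then show "u \<in> verts (und (inflate P A'))"
        using lab[OF up_v labD(1)[OF _ up_v], of x v] by (simp add: pr_simps over_pr)
    next
      fix u
      assume "u \<in> verts (und (inflate P A'))"
      then obtain i v y where v: "v \<in> verts (und G)" "u = (pr i v, y)"
          "y \<in> labels P A' (pr i ` over G v)"
        by (auto simp: verts_P over_pr)
      obtain x where x: "dom x = over G v" "?t x = y" "b \<in> over G v \<Longrightarrow> ?s x = i"
        using surjE[OF up_v v(3)] by blast
      \<comment> \<open>Either \<open>b\<close> is labelled and the side is \<open>i\<close>, or
        everything in question is outside the box and the side is immaterial.\<close>
      have pr_eq: "pr (?s x) w = pr i w" if "w = v \<or> w \<in> over G v" for w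
        using that x(3) pr_outside_box[OF v(1)] pr_image_outside_box[OF up_v] by (cases "b \<in> over G v") auto
      then have "pr (?s x) ` over G v = pr i ` over G v" by (intro image_cong) auto
      then have "x \<in> labels G A (over G v)"
        using lab[OF up_v x(1)] v x by simp
      then show "u \<in> ?f ` verts (und (inflate G A))"
        using v x pr_eq by (auto intro!: rev_image_eqI[of "(v, x)"])
    qed
  qed
  have be: "bij_betw (\<lambda>(e, x). (pe (?s x) e, ?t x)) (arcs (und (inflate G A)))
      (arcs (und (inflate P A')))"
    (is "bij_betw ?g _ _")
  proof (rule bij_betw_imageI)
    have b_over: "b \<in> arc_over G e \<longleftrightarrow>
        (b, tail (und G) e) \<in> arcs_ends (und G) \<or> (b, head (und G) e) \<in> arcs_ends (und G)" for e
      using bang by (auto simp: arc_over_def over_def)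
    show "inj_on ?g (arcs (und (inflate G A)))"
    proof (rule inj_onI, clarify)
      fix e x d y
      assume *: "(e, x) \<in> arcs (und (inflate G A))" "(d, y) \<in> arcs (und (inflate G A))"
        and eq: "pe (?s x) e = pe (?s y) d" "?t x = ?t y"
      then have ed: "e = d" "?s x = ?s y \<or> b \<notin> arc_over G e"
        using pe_eq_iff[of e d "?s x" "?s y"] by (auto simp: b_over)
      then have x: "x \<in> labels G A (arc_over G e)" "y \<in> labels G A (arc_over G e)" using * by auto
      have "?s x = ?s y"
      proof (cases "b \<in> arc_over G e")
        case True
        then show ?thesis using ed by simp
      next
        case False
        then have "x b = None" "y b = None" using x labD(1)[OF _ up_e] by auto
        then show ?thesis by (simp add: side_def)
      qed
      then show "e = d \<and> x = y"
        using transport_inj[OF inj, of x y] eq ed labD[OF x(1) up_e] labD[OF x(2) up_e] by simp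
    qed
    show "?g ` arcs (und (inflate G A)) = arcs (und (inflate P A'))"
    proof (intro equalityI subsetI)
      fix u
      assume "u \<in> ?g ` arcs (und (inflate G A))"
      then obtain e x where "e \<in> arcs (und G)" "x \<in> labels G A (arc_over G e)"
          "u = (pe (?s x) e, ?t x)"
        by auto
      then show "u \<in> arcs (und (inflate P A'))"
        using lab[OF up_e labD(1)[OF _ up_e], of x e] by (simp add: pe_simps arc_over_pe)
    next
      fix u
      assume "u \<in> arcs (und (inflate P A'))"
      then obtain i e y where e: "e \<in> arcs (und G)" "u = (pe i e, y)"
          "y \<in> labels P A' (pr i ` arc_over G e)"
        by (auto simp: arcs_P arc_over_pe)
      obtain x where x: "dom x = arc_over G e" "?t x = y" "b \<in> arc_over G e \<Longrightarrow> ?s x = i"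
        using surjE[OF up_e e(3)] by blast
      have "pr (?s x) ` arc_over G e = pr i ` arc_over G e"
        using x(3) pr_image_outside_box[OF up_e] by (cases "b \<in> arc_over G e") (auto intro!: image_cong)
      then have "x \<in> labels G A (arc_over G e)"
        using lab[OF up_e x(1)] e x by simp
      moreover have "pe (?s x) e = pe i e"
        using x(3) pe_eq_iff[OF e(1) e(1)] by (auto simp: b_over)
      ultimately show "u \<in> ?g ` arcs (und (inflate G A))"
        using e x by (auto intro!: rev_image_eqI[of "(e, x)"])
    qed
  qed
  have ends: "?t (x |` over G v) = ?t x |` over P (pr (?s x) v)"
      "pr (?s (x |` over G v)) v = pr (?s x) v"
    if "v \<in> verts (und G)" "over G v \<subseteq> arc_over G e" "x \<in> labels G A (arc_over G e)" for v e x
    using that transport_restrict[OF up_e labD(1)[OF _ up_e] up_v]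
    by (auto simp: over_pr pr_side_restrict)
  have "tg_hom (inflate G A) (inflate P A') (?f, ?g)"
    unfolding tg_hom_def graph_hom_def
  proof (intro conjI ballI)
    fix u
    assume u: "u \<in> verts (und (inflate G A))"
    then show "fst (?f, ?g) u \<in> verts (und (inflate P A'))"
      using bij_betwE[OF bv] unfolding fst_conv by blast
    show "vtyp (inflate P A') (fst (?f, ?g) u) = vtyp (inflate G A) u"
      using u by (auto simp: pr_simps)
  next
    fix u
    assume u: "u \<in> arcs (und (inflate G A))"
    then show "snd (?f, ?g) u \<in> arcs (und (inflate P A'))"
      using bij_betwE[OF be] unfolding snd_conv by blast
    obtain e x where e: "u = (e, x)" "e \<in> arcs (und G)" "x \<in> labels G A (arc_over G e)"
      using u by auto
    have sub: "over G (tail (und G) e) \<subseteq> arc_over G e" "over G (head (und G) e) \<subseteq> arc_over G e"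
      by (auto simp: arc_over_def)
    show "etyp (inflate P A') (snd (?f, ?g) u) = etyp (inflate G A) u"
      "tail (und (inflate P A')) (snd (?f, ?g) u) = fst (?f, ?g) (tail (und (inflate G A)) u)"
      "head (und (inflate P A')) (snd (?f, ?g) u) = fst (?f, ?g) (head (und (inflate G A)) u)"
      using e ends[OF _ sub(1) e(3)] ends[OF _ sub(2) e(3)] by (auto simp: pe_simps)
  qed
  then show ?thesis
    using bv be unfolding tg_iso_iff is_tg_iso_def by (intro exI conjI) (assumption | simp)+
qed

end

subsection \<open>Elementwise copies and pushouts\<close>

abbreviation outside_box :: "('v, 'e, 'o, 'm) tgraph \<Rightarrow> 'v \<Rightarrow> ('v, 'e, 'o, 'm) tgraph" where
  "outside_box G b \<equiv> remove_verts G (verts (und (bang_box G b)))"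

lemma hom_eq_outside_box:
  assumes "box_graph T G"
  shows "hom_eq (outside_box G b) f g \<longleftrightarrow>
    (\<forall>v \<in> verts (und G). (b, v) \<notin> arcs_ends (und G) \<longrightarrow> fst f v = fst g v) \<and>
    (\<forall>e \<in> arcs (und G). (b, tail (und G) e) \<notin> arcs_ends (und G) \<longrightarrow>
      (b, head (und G) e) \<notin> arcs_ends (und G) \<longrightarrow> snd f e = snd g e)"
proof -
  interpret wf_digraph "und G" by (rule box_graphD(4)[OF assms])
  show ?thesis
    by (auto simp: hom_eq_def remove_verts_def verts_bang_box[OF assms])
qed

context box_copy
begin

definition arc_proj :: "'e \<Rightarrow> 'e" where
  "arc_proj x = (SOME e. e \<in> arcs (und G) \<and> (\<exists>i. x = pe i e))"

lemma arc_proj_pe: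
  assumes "e \<in> arcs (und G)"
  shows "arc_proj (pe i e) = e"
  unfolding arc_proj_def using assms by (intro some_equality) (auto simp: pe_eq_iff)

text \<open>Define the map as \<open>m False\<close> on the image of the first coprojection and as
  \<open>m True\<close> elsewhere; the two agree on shared elements by \<open>eq\<close>.\<close>

lemma copairing:
  fixes m :: "bool \<Rightarrow> ('v \<Rightarrow> 'w) \<times> ('e \<Rightarrow> 'd)"
  assumes m: "\<And>i. tg_hom G Q (m i)" and eq: "hom_eq (outside_box G b) (m False) (m True)"
  obtains u where "tg_hom P Q u"
    "\<And>i v. v \<in> verts (und G) \<Longrightarrow> fst u (pr i v) = fst (m i) v"
    "\<And>i e. e \<in> arcs (und G) \<Longrightarrow> snd u (pe i e) = snd (m i) e"
proof -
  define u where "u = (\<lambda>x. fst (m (x \<notin> pr False ` verts (und G))) (proj x),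
    \<lambda>x. snd (m (x \<notin> pe False ` arcs (und G))) (arc_proj x))"
  note eqs = eq[unfolded hom_eq_outside_box[OF box_graph]]
  have uv: "fst u (pr i v) = fst (m i) v" if v: "v \<in> verts (und G)" for i v
  proof (cases "i \<and> (b, v) \<in> arcs_ends (und G)")
    case True
    then have "pr i v \<notin> pr False ` verts (und G)"
      using v by (auto simp: pr_eq_iff)
    then show ?thesis using True v by (simp add: u_def proj_pr)
  next
    case False
    then have "pr i v = pr False v" "fst (m i) v = fst (m False) v"
      using v eqs pr_eq_iff[OF v v, of i False] by (cases i; simp)+
    then show ?thesis using v proj_pr[OF v, of False] by (simp add: u_def)
  qed
  have ue: "snd u (pe i e) = snd (m i) e" if e: "e \<in> arcs (und G)" for i e
  proof (cases "i \<and> ((b, tail (und G) e) \<in> arcs_ends (und G) \<or> (b, head (und G) e) \<in> arcs_ends (und G))")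
    case True
    then have "pe i e \<notin> pe False ` arcs (und G)"
      using e by (auto simp: pe_eq_iff)
    then show ?thesis using True e by (simp add: u_def arc_proj_pe)
  next
    case False
    then have "pe i e = pe False e" "snd (m i) e = snd (m False) e"
      using e eqs pe_eq_iff[OF e e, of i False] by (cases i; simp)+
    then show ?thesis using e arc_proj_pe[OF e, of False] by (simp add: u_def)
  qed
  have "tg_hom P Q u"
    using m unfolding tg_hom_def graph_hom_def verts_P arcs_P
    by (auto simp: uv ue pe_simps pr_simps)
  then show thesis using that uv ue by blast
qed

text \<open>Existence is \<open>copairing\<close>; uniqueness holds because the coprojections are
  jointly surjective on vertices and on arcs.\<close>

lemma is_pushout:
  "is_pushout (bang_typegraph T) (outside_box G b) G G (id, id) (id, id) P
     (pr False, pe False) (pr True, pe True)"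
  unfolding is_pushout_def
proof (intro conjI allI impI)
  show "hom_eq (outside_box G b) (hom_comp (pr False, pe False) (id, id))
      (hom_comp (pr True, pe True) (id, id))"
    unfolding hom_eq_outside_box[OF box_graph] by (auto simp: hom_comp_def pr_eq_iff pe_eq_iff)
  fix Q :: "('v, 'e, 'o, 'm) tgraph" and h k
  assume *: "typed_over (bang_typegraph T) Q \<and> tg_hom G Q h \<and> tg_hom G Q k \<and>
    hom_eq (outside_box G b) (hom_comp h (id, id)) (hom_comp k (id, id))"
  define m where "m i = (if i then k else h)" for i
  have m: "tg_hom G Q (m i)" for i using * by (simp add: m_def)
  have m_eq: "hom_eq (outside_box G b) (m False) (m True)"
    using * by (simp add: m_def hom_eq_def hom_comp_def)
  obtain u where u: "tg_hom P Q u"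
    "\<And>i v. v \<in> verts (und G) \<Longrightarrow> fst u (pr i v) = fst (m i) v"
    "\<And>i e. e \<in> arcs (und G) \<Longrightarrow> snd u (pe i e) = snd (m i) e"
    using copairing[OF m m_eq] by blast
  have comp: "hom_eq G (hom_comp u' (pr i, pe i)) (m i) \<longleftrightarrow>
      (\<forall>v \<in> verts (und G). fst u' (pr i v) = fst (m i) v) \<and>
      (\<forall>e \<in> arcs (und G). snd u' (pe i e) = snd (m i) e)" for u' i
    by (simp add: hom_eq_def hom_comp_def)
  have hk: "h = m False" "k = m True" by (simp_all add: m_def)
  show "\<exists>u. tg_hom P Q u \<and> hom_eq G (hom_comp u (pr False, pe False)) h \<and>
      hom_eq G (hom_comp u (pr True, pe True)) k \<and>
      (\<forall>u'. tg_hom P Q u' \<and> hom_eq G (hom_comp u' (pr False, pe False)) h \<and>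
        hom_eq G (hom_comp u' (pr True, pe True)) k \<longrightarrow> hom_eq P u' u)"
  proof (intro exI[of _ u] conjI allI impI)
    show "hom_eq G (hom_comp u (pr False, pe False)) h" "hom_eq G (hom_comp u (pr True, pe True)) k"
      unfolding hk comp using u by simp_all
    fix u'
    assume "tg_hom P Q u' \<and> hom_eq G (hom_comp u' (pr False, pe False)) h \<and>
        hom_eq G (hom_comp u' (pr True, pe True)) k"
    then have "fst u' (pr i v) = fst (m i) v" if "v \<in> verts (und G)" for i v
      unfolding hk comp using that by (cases i) simp_all
    moreover have "snd u' (pe i e) = snd (m i) e" if "e \<in> arcs (und G)" for i e
      using \<open>tg_hom P Q u' \<and> _\<close> that unfolding hk comp by (cases i) simp_all
    ultimately show "hom_eq P u' u"
      unfolding hom_eq_def verts_P arcs_P using u by auto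
  qed (fact u)
qed (rule typed hom)+

lemma is_copy: "is_copy T b G P (pr False b) (pr True b)"
  unfolding is_copy_def using is_pushout by (metis fst_conv)

end

section \<open>Every COPY is an elementwise copy\<close>

lemma ex_fresh_renaming:
  fixes S :: "'a::infinite set"
  assumes "finite S"
  obtains f :: "'a \<Rightarrow> 'a" where "inj_on f S" "\<And>x. f x \<notin> S"
proof -
  obtain g :: "nat \<Rightarrow> 'a" where g: "inj g" "range g \<subseteq> UNIV - S"
    using arb_countable_map[OF assms] by blast
  obtain h :: "'a \<Rightarrow> nat" where h: "inj_on h S"
    using finite_imp_inj_to_nat_seg[OF assms] by blast
  have "inj_on (g \<circ> h) S"
    using h g(1) by (simp add: comp_inj_on inj_on_subset)
  moreover have "(g \<circ> h) x \<notin> S" for x using g(2) by auto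
  ultimately show thesis by (rule that)
qed

text \<open>The first copy of \<open>G\<close> stays in place. In the second one, the vertices in
  the box and the arcs touching it get fresh names, available because \<open>G\<close> is finite and
  the types are infinite.\<close>

lemma ex_box_copy:
  fixes G :: "('v::infinite, 'e::infinite, 'o, 'm) tgraph"
  assumes G: "box_graph T G" and b: "b \<in> bang_verts G"
  obtains P pr pe where "box_copy T G b P pr pe"
proof -
  interpret wf_digraph "und G" by (rule box_graphD(4)[OF G])
  let ?V = "verts (und G)" and ?E = "arcs (und G)"
  let ?B = "\<lambda>v. (b, v) \<in> arcs_ends (und G)"
  let ?C = "\<lambda>e. ?B (tail (und G) e) \<or> ?B (head (und G) e)"
  obtain f :: "'v \<Rightarrow> 'v" where f: "inj_on f ?V" "\<And>x. f x \<notin> ?V"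
    using ex_fresh_renaming[OF box_graphD(1)[OF G]] by blast
  obtain g :: "'e \<Rightarrow> 'e" where g: "inj_on g ?E" "\<And>x. g x \<notin> ?E"
    using ex_fresh_renaming[OF box_graphD(2)[OF G]] by blast
  define pr where "pr i v = (if i \<and> ?B v then f v else v)" for i v
  define pe where "pe i e = (if i \<and> ?C e then g e else e)" for i e
  \<comment> \<open>A fresh arc is traced back to its original, whose end is then moved into the
    second copy; \<open>pr True\<close> fixes ends outside the box.\<close>
  define ends where "ends t x = (if x \<in> ?E then t x else pr True (t (inv_into ?E g x)))" for t x
  define P :: "('v, 'e, 'o, 'm) tgraph" where "P = \<lparr>
    und = \<lparr> verts = (\<Union>i. pr i ` ?V), arcs = (\<Union>i. pe i ` ?E),
      tail = ends (tail (und G)), head = ends (head (und G)) \<rparr>,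
    vtyp = (\<lambda>x. vtyp G (if x \<in> ?V then x else inv_into ?V f x)),
    etyp = (\<lambda>x. etyp G (if x \<in> ?E then x else inv_into ?E g x)) \<rparr>"
  have vt: "vtyp P (pr i v) = vtyp G v" if "v \<in> ?V" for i v
    using that f by (simp add: P_def pr_def)
  have et: "etyp P (pe i e) = etyp G e" if "e \<in> ?E" for i e
    using that g by (simp add: P_def pe_def)
  have tl: "tail (und P) (pe i e) = pr i (tail (und G) e)" if "e \<in> ?E" for i e
    using that g by (auto simp: P_def pe_def pr_def ends_def)
  have hd: "head (und P) (pe i e) = pr i (head (und G) e)" if "e \<in> ?E" for i e
    using that g by (auto simp: P_def pe_def pr_def ends_def)
  have P_sets: "verts (und P) = (\<Union>i. pr i ` ?V)" "arcs (und P) = (\<Union>i. pe i ` ?E)"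
    by (simp_all add: P_def)
  have pr_in: "pr i v \<in> verts (und P)" if "v \<in> ?V" for i v
    using that unfolding P_sets by blast
  have pe_in: "pe i e \<in> arcs (und P)" if "e \<in> ?E" for i e
    using that unfolding P_sets by blast
  have typed_G: "graph_hom (und G) (bang_typegraph T) (vtyp G, etyp G)"
    using box_graphD(3)[OF G] by (simp add: typed_over_def)
  have "wf_digraph (und P)"
    by (rule wf_digraph.intro) (auto simp: P_sets(2) tl hd pr_in)
  moreover have "graph_hom (und P) (bang_typegraph T) (vtyp P, etyp P)"
    using typed_G by (auto simp: graph_hom_def P_sets vt et tl hd)
  ultimately have "typed_over (bang_typegraph T) P"
    by (simp add: typed_over_def)
  moreover have "tg_hom G P (pr i, pe i)" for i
    by (auto simp: tg_hom_def graph_hom_def pr_in pe_in vt et tl hd)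
  moreover have "pr i v = pr j w \<longleftrightarrow> v = w \<and> (i = j \<or> \<not> ?B v)" if "v \<in> ?V" "w \<in> ?V" for v w i j
    using that f inj_onD[OF f(1), of v w] by (auto simp: pr_def)
  moreover have "pe i e = pe j d \<longleftrightarrow> e = d \<and> (i = j \<or> \<not> ?B (tail (und G) e) \<and> \<not> ?B (head (und G) e))"
    if "e \<in> ?E" "d \<in> ?E" for e d i j
    using that g(2)[of e] g(2)[of d] inj_onD[OF g(1), of e d] by (auto simp: pe_def split: if_splits)
  ultimately have "box_copy T G b P pr pe"
    unfolding box_copy_def using G b P_sets by blast
  then show thesis by (rule that)
qed

text \<open>Compare the given pushout with an explicit one, \<open>Q\<close>. The comparison maps
  \<open>u\<close> and \<open>w\<close> exchange the coprojections, so equalities between images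
  agree in \<open>P\<close> and \<open>Q\<close>; joint surjectivity for \<open>P\<close> follows
  from \<open>w \<circ> u\<close> being the identity.\<close>

lemma is_copy_imp_box_copy:
  fixes G :: "('v::infinite, 'e::infinite, 'o, 'm) tgraph"
  assumes G: "box_graph T G" and b: "b \<in> bang_verts G" and copy: "is_copy T b G P b0 b1"
  obtains pr pe where "box_copy T G b P pr pe"
proof -
  obtain p q where po: "is_pushout (bang_typegraph T) (outside_box G b) G G (id, id) (id, id) P p q"
    using copy by (auto simp: is_copy_def)
  obtain Q qr qe where "box_copy T G b Q qr qe"
    using ex_box_copy[OF G b] .
  then interpret Q: box_copy T G b Q qr qe .
  define m where "m i = (if i then q else p)" for i
  have P: "typed_over (bang_typegraph T) P" and hom: "tg_hom G P (m i)"
    and eq: "hom_eq (outside_box G b) (m False) (m True)" for i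
    using po by (simp_all add: is_pushout_def m_def hom_comp_def hom_eq_def)
  obtain u where u: "tg_hom P Q u" "hom_eq G (hom_comp u p) (qr False, qe False)"
      "hom_eq G (hom_comp u q) (qr True, qe True)"
    using po Q.is_pushout unfolding is_pushout_def by blast
  then have uv: "fst u (fst (m i) v) = qr i v" if "v \<in> verts (und G)" for i v
    using that by (auto simp: m_def hom_eq_def hom_comp_def)
  have ue: "snd u (snd (m i) e) = qe i e" if "e \<in> arcs (und G)" for i e
    using that u by (auto simp: m_def hom_eq_def hom_comp_def)
  obtain w where w: "tg_hom Q P w"
      "\<And>i v. v \<in> verts (und G) \<Longrightarrow> fst w (qr i v) = fst (m i) v"
      "\<And>i e. e \<in> arcs (und G) \<Longrightarrow> snd w (qe i e) = snd (m i) e"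
    using Q.copairing[OF hom eq] by blast
  \<comment> \<open>Both \<open>w \<circ> u\<close> and the identity are compatible with the
    coprojections of \<open>P\<close>, so the uniqueness clause with test object \<open>P\<close>
    identifies them.\<close>
  have wu: "hom_eq P (hom_comp w u) (id, id)"
  proof -
    obtain z where z: "hom_eq P u' z" if "tg_hom P P u'" "hom_eq G (hom_comp u' p) p"
        "hom_eq G (hom_comp u' q) q" for u'
      using po unfolding is_pushout_def by blast
    have "hom_eq P (hom_comp w u) z"
      using uv[of _ False] uv[of _ True] ue[of _ False] ue[of _ True]
        w(2)[of _ False] w(2)[of _ True] w(3)[of _ False] w(3)[of _ True]
      by (intro z tg_hom_comp[OF u(1) w(1)]) (simp_all add: hom_eq_def hom_comp_def m_def)
    moreover have "hom_eq P (id, id) z"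
      by (rule z) (simp_all add: tg_hom_id hom_eq_def hom_comp_def)
    ultimately show ?thesis by (simp add: hom_eq_def)
  qed
  have "verts (und P) = (\<Union>i. fst (m i) ` verts (und G))"
  proof (intro equalityI subsetI)
    fix x
    assume x: "x \<in> verts (und P)"
    then have "fst u x \<in> verts (und Q)"
      using u(1) by (simp add: tg_hom_def graph_hom_def)
    then obtain i v where "v \<in> verts (und G)" "fst u x = qr i v"
      by (auto simp: Q.verts_P)
    moreover have "fst w (fst u x) = x"
      using wu x by (simp add: hom_eq_def hom_comp_def)
    ultimately show "x \<in> (\<Union>i. fst (m i) ` verts (und G))"
      using w(2)[of v i] by auto
  qed (use hom in \<open>auto simp: tg_hom_def graph_hom_def\<close>)
  moreover have "arcs (und P) = (\<Union>i. snd (m i) ` arcs (und G))"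
  proof (intro equalityI subsetI)
    fix x
    assume x: "x \<in> arcs (und P)"
    then have "snd u x \<in> arcs (und Q)"
      using u(1) by (simp add: tg_hom_def graph_hom_def)
    then obtain i e where "e \<in> arcs (und G)" "snd u x = qe i e"
      by (auto simp: Q.arcs_P)
    moreover have "snd w (snd u x) = x"
      using wu x by (simp add: hom_eq_def hom_comp_def)
    ultimately show "x \<in> (\<Union>i. snd (m i) ` arcs (und G))"
      using w(3)[of e i] by auto
  qed (use hom in \<open>auto simp: tg_hom_def graph_hom_def\<close>)
  moreover have "fst (m i) v = fst (m j) v' \<longleftrightarrow> qr i v = qr j v'"
    if "v \<in> verts (und G)" "v' \<in> verts (und G)" for i j v v'
    using that uv w(2) by metis
  moreover have "snd (m i) e = snd (m j) e' \<longleftrightarrow> qe i e = qe j e'"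
    if "e \<in> arcs (und G)" "e' \<in> arcs (und G)" for i j e e'
    using that ue w(3) by metis
  ultimately have "box_copy T G b P (\<lambda>i. fst (m i)) (\<lambda>i. snd (m i))"
    unfolding box_copy_def using G b P hom Q.pr_eq_iff Q.pe_eq_iff by simp
  then show thesis by (rule that)
qed

subsection \<open>Instances as inflations\<close>

lemma full_sub_full_sub: "full_sub (full_sub G S) S' = full_sub G (S \<inter> S')"
  by (auto simp: full_sub_def induce_subgraph_def Int_assoc intro!: arg_cong[where f = "\<lambda>D. G\<lparr>und := D\<rparr>"])

lemma full_sub_cong:
  assumes "verts (und G) \<inter> S = verts (und G) \<inter> S'"
  shows "full_sub G S = full_sub G S'"
  unfolding full_sub_def assms ..

lemma unbang_remove_verts:
  assumes "verts (und X) \<inter> W \<subseteq> bang_verts X"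
  shows "unbang (remove_verts X W) = unbang X"
  unfolding unbang_def remove_verts_def bang_verts_full_sub full_sub_full_sub
  using assms by (intro full_sub_cong) auto

lemma unbang_inflate_drop:
  assumes "box_graph T G" "b \<in> bang_verts G"
    and iso: "remove_verts (inflate G A) {v. fst v = b} \<simeq> inflate (drop_bang b G) A'"
  shows "unbang (inflate G A) \<simeq> unbang (inflate (drop_bang b G) A')"
proof -
  have "unbang (remove_verts (inflate G A) {v. fst v = b}) = unbang (inflate G A)"
    using assms(2) by (intro unbang_remove_verts) (auto simp: bang_verts_inflate)
  moreover have "wf_digraph (und (remove_verts (inflate G A) {v. fst v = b}))"
    unfolding remove_verts_def by (rule wf_digraph_full_sub[OF wf_digraph_inflate[OF assms(1)]])
  ultimately show ?thesis
    using tg_iso_unbang[OF iso] by simp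
qed

section \<open>Pulling admissibility back along COPY, DROP and KILL\<close>

text \<open>The label \<open>n\<close> of \<open>b\<close> stands for label \<open>n div 2\<close>
  in the copy given by the parity of \<open>n\<close>. Every pair has a code, and each old name
  yields at most two new ones at \<open>b\<close>.\<close>

lemma (in box_copy) copy_inflate_inverse:
  assumes "fin_names A'"
  shows "\<exists>A. fin_names A \<and> inflate G A \<simeq> inflate P A'"
proof -
  let ?\<nu> = "\<lambda>n :: nat. n div 2"
  define A where "A a x \<longleftrightarrow> a \<in> bang_verts G \<and> dom x = over G a \<and>
    A' (pr (side odd x) a) (transport odd ?\<nu> x)" for a x
  have "inflate G A \<simeq> inflate P A'"
  proof (rule inflate_copy)
    show "inj (\<lambda>n. (odd n, n div 2 :: nat))"
      by (rule injI) (metis Pair_inject bit_eq_rec)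
    show "A a x \<longleftrightarrow> A' (pr (side odd x) a) (transport odd ?\<nu> x)"
      if "a \<in> bang_verts G" "dom x = over G a" for a x
      using that by (simp add: A_def)
    fix y i
    assume y: "dom y = over P (pr i b)" "A' (pr i b) y"
    have "pr i b \<in> over P (pr i b)"
      using bang by (intro self_in_over[OF box_graph_P]) (auto simp: bang_verts_P)
    then obtain m where "y (pr i b) = Some m" using y by blast
    then show "\<exists>n. odd n = i \<and> y (pr i b) = Some (n div 2)"
      by (intro exI[of _ "2 * m + of_bool i"]) auto
  qed
  moreover have "fin_names A"
  proof -
    let ?N = "{n. \<exists>a x. A' a x \<and> x a = Some n}"
    have "n \<in> ?N \<union> (\<Union>m \<in> ?N. {2 * m, 2 * m + 1})" if n: "A a x" "x a = Some n" for a x n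
    proof -
      let ?a = "pr (side odd x) a" and ?x = "transport odd ?\<nu> x"
      have A': "A' ?a ?x" "a \<in> verts (und G)" "dom x \<subseteq> verts (und G)"
        using n over_subset_verts[of a] by (auto simp: A_def bang_verts_def)
      then have "?x ?a = Some (if a = b then n div 2 else n)"
        using transport_pr[of a x odd ?\<nu>] n(2) by auto
      then have N: "(if a = b then n div 2 else n) \<in> ?N" using A' by blast
      show ?thesis
      proof (cases "a = b")
        case True
        then have "n div 2 \<in> ?N" using N by simp
        moreover have "n \<in> {2 * (n div 2), 2 * (n div 2) + 1}"
          by (simp, presburger)
        ultimately show ?thesis by (intro UnI2 UN_I)
      next
        case False
        then show ?thesis using N by (intro UnI1) simp
      qed
    qed
    then have "{n. \<exists>a x. A a x \<and> x a = Some n} \<subseteq> ?N \<union> (\<Union>m \<in> ?N. {2 * m, 2 * m + 1})" by blast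
    moreover have "finite (?N \<union> (\<Union>m \<in> ?N. {2 * m, 2 * m + 1}))"
      using assms by (simp add: fin_names_def)
    ultimately show ?thesis
      unfolding fin_names_def by (rule finite_subset)
  qed
  ultimately show ?thesis by blast
qed

lemma bang_step_inflate:
  fixes G :: "('v::infinite, 'e::infinite, 'o, 'm) tgraph"
  assumes step: "bang_step T G G'" and G: "box_graph T G"
  shows "box_graph T G'"
    and "fin_names A' \<Longrightarrow> \<exists>A. fin_names A \<and> unbang (inflate G A) \<simeq> unbang (inflate G' A')"
proof -
  have "box_graph T G' \<and> (fin_names A' \<longrightarrow>
      (\<exists>A. fin_names A \<and> unbang (inflate G A) \<simeq> unbang (inflate G' A')))"
    using step
  proof cases
    case (copy b b0 b1)
    then obtain pr pe where "box_copy T G b G' pr pe"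
      using is_copy_imp_box_copy[OF G] by blast
    then interpret box_copy T G b G' pr pe .
    show ?thesis
      using box_graph_P copy_inflate_inverse tg_iso_unbang wf_digraph_inflate[OF G] by blast
  next
    case (drop b)
    \<comment> \<open>DROP keeps one instance of the box contents, so \<open>b\<close> gets exactly
      one copy, numbered 0; other tests ignore its label.\<close>
    let ?A = "\<lambda>a x. if a = b then x b = Some 0 else A' a (x |` (- {b}))"
    have "remove_verts (inflate G ?A) {v. fst v = b} \<simeq> inflate (drop_bang b G) A'"
      by (rule inflate_drop[OF G drop(2), of _ 0]) auto
    then have "unbang (inflate G ?A) \<simeq> unbang (inflate (drop_bang b G) A')"
      by (rule unbang_inflate_drop[OF G drop(2)])
    moreover have "fin_names ?A" if "fin_names A'"
    proof -
      have "n \<in> insert 0 {n. \<exists>a x. A' a x \<and> x a = Some n}" if "?A a x" "x a = Some n" for a x n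
      proof (cases "a = b")
        case False
        then have "A' a (x |` (- {b}))" "(x |` (- {b})) a = Some n" using that by auto
        then show ?thesis by blast
      qed (use that in auto)
      then have "{n. \<exists>a x. ?A a x \<and> x a = Some n} \<subseteq> insert 0 {n. \<exists>a x. A' a x \<and> x a = Some n}"
        by blast
      then show ?thesis
        using that finite_subset unfolding fin_names_def by blast
    qed
    ultimately show ?thesis
      using drop box_graph_full_sub[OF G] by (auto simp: drop_bang_def remove_verts_def)
  next
    case (kill b)
    \<comment> \<open>No !-vertex in the box of \<open>b\<close>, in particular not \<open>b\<close>
      itself, has an admissible copy.\<close>
    let ?A = "\<lambda>a x. (b, a) \<notin> arcs_ends (und G) \<and> A' a x"
    have "inflate G ?A \<simeq> inflate (kill_bang b G) A'"
    proof (rule inflate_kill[OF G kill(2)])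
      show "labels G ?A (over G b) = {}"
        using self_in_over[OF G kill(2)] box_graphD(5)[OF G kill(2)] by (auto simp: labels_def)
    qed simp
    then have "unbang (inflate G ?A) \<simeq> unbang (inflate (kill_bang b G) A')"
      by (rule tg_iso_unbang) (rule wf_digraph_inflate[OF G])
    moreover have "fin_names ?A" if "fin_names A'"
      using that unfolding fin_names_def by (rule rev_finite_subset) blast
    ultimately show ?thesis
      using kill box_graph_full_sub[OF G] by (auto simp: kill_bang_def remove_verts_def)
  qed
  then show "box_graph T G'"
    "fin_names A' \<Longrightarrow> \<exists>A. fin_names A \<and> unbang (inflate G A) \<simeq> unbang (inflate G' A')"
    by blast+
qed

text \<open>Runs through the instantiation backwards, from the concrete end, pulling the predicate
  back at each step. The end has no !-vertices to test, so the constantly false predicate serves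
  there.\<close>

lemma concrete_instance_inflate:
  fixes G K :: "('v::infinite, 'e::infinite, 'o, 'm) tgraph"
  assumes "(bang_step T)\<^sup>*\<^sup>* G K" "box_graph T G" "concrete K"
  shows "\<exists>A. fin_names A \<and> unbang (inflate G A) \<simeq> K"
  using assms(1,2)
proof (induction rule: converse_rtranclp_induct)
  case base
  have wf: "wf_digraph (und K)" by (rule box_graphD(4)[OF base])
  have "unbang (inflate K (\<lambda>_ _. False)) \<simeq> K"
    using tg_iso_sym[OF unbang_inflate_concrete[OF wf assms(3)] wf] .
  then show ?case by (intro exI[of _ "\<lambda>_ _. False"]) (simp add: fin_names_def)
next
  case (step G G')
  then obtain A' where A': "fin_names A'" "unbang (inflate G' A') \<simeq> K"
    using bang_step_inflate(1) by blast
  then obtain A where "fin_names A" "unbang (inflate G A) \<simeq> unbang (inflate G' A')"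
    using bang_step_inflate(2)[OF step(1,4)] by blast
  then show ?case using A' tg_iso_trans by blast
qed

subsection \<open>Expansion-normal form\<close>

lemma (in box_copy) exp_inflate:
  assumes only: "over G b = {b}" and x0: "x0 \<in> labels G A {b}"
  shows "\<exists>A'. unbang (inflate G A) \<simeq> unbang (inflate (drop_bang (pr True b) P) A') \<and>
    (finite (bang_verts (inflate G A)) \<longrightarrow>
      finite (bang_verts (inflate (drop_bang (pr True b) P) A')) \<and>
      card (bang_verts (inflate (drop_bang (pr True b) P) A')) < card (bang_verts (inflate G A)))"
proof -
  have dom_x0: "dom x0 = {b}" and "A b (x0 |` {b})"
    using x0 only by (auto simp: labels_def)
  moreover have "x0 |` {b} = x0"
    using dom_x0 by (auto simp: restrict_map_def fun_eq_iff domIff)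
  ultimately have A_x0: "A b x0" by simp
  obtain n0 where n0: "x0 b = Some n0" using dom_x0 by blast
  let ?\<sigma> = "\<lambda>n. n = n0" and ?\<nu> = "\<lambda>n :: nat. n" and ?b = "pr True b"
  let ?t = "transport ?\<sigma> ?\<nu>" and ?s = "side ?\<sigma>"
  let ?D = "drop_bang ?b P"
  have bV: "b \<in> verts (und G)" using bang by (simp add: bang_verts_def)
  have bP: "?b \<in> bang_verts P" using bang by (auto simp: bang_verts_P)
  have over_b: "over P ?b = {?b}" by (simp add: over_pr[OF bV] only)
  have inj: "inj (\<lambda>n. (?\<sigma> n, ?\<nu> n))" by (simp add: inj_def)
  \<comment> \<open>The image of \<open>A\<close> under transport;
    \<open>transport_determines\<close> makes preimages unique, so no unwanted pair becomes
    admissible.\<close>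
  define A' where "A' a' y \<longleftrightarrow>
    (\<exists>a x. a \<in> bang_verts G \<and> dom x = over G a \<and> a' = pr (?s x) a \<and> y = ?t x \<and> A a x)" for a' y
  have A'_iff: "A a x \<longleftrightarrow> A' (pr (?s x) a) (?t x)" if a: "a \<in> bang_verts G" "dom x = over G a" for a x
  proof
    assume "A' (pr (?s x) a) (?t x)"
    then obtain c z where cz: "c \<in> bang_verts G" "dom z = over G c" "pr (?s x) a = pr (?s z) c"
        "?t x = ?t z" "A c z"
      by (auto simp: A'_def)
    have "a = c" "x = z"
      using a cz by (auto simp: bang_verts_def intro: transport_determines[OF inj])
    then show "A a x" using cz by simp
  qed (use a in \<open>auto simp: A'_def\<close>)
  have A'_b: "\<exists>n. ?\<sigma> n = i \<and> y (pr i b) = Some (?\<nu> n)" if "A' (pr i b) y" for y i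
  proof -
    obtain c z where cz: "c \<in> bang_verts G" "dom z = over G c" "pr i b = pr (?s z) c" "y = ?t z"
      using \<open>A' (pr i b) y\<close> by (auto simp: A'_def)
    have c: "c = b" "?s z = i"
      using cz pr_eq_iff[OF bV, of c i "?s z"] box_graphD(5)[OF box_graph bang]
      by (auto simp: bang_verts_def)
    then have "b \<in> dom z" using cz only by simp
    then obtain n where n: "z b = Some n" by blast
    have "dom z \<subseteq> verts (und G)"
      unfolding cz(2) by (rule over_subset_verts)
    from transport_pr[OF bV this, of ?\<sigma> ?\<nu>] have "y (pr i b) = Some n"
      unfolding c cz(4) by (simp add: n)
    then show ?thesis using n c(2) by (auto simp: side_def)
  qed
  have iso: "inflate G A \<simeq> inflate P A'"
    by (rule inflate_copy[where \<sigma> = ?\<sigma> and \<nu> = ?\<nu>]) (fact inj A'_iff | erule A'_b)+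
  have s_x0: "?s x0 = True" by (simp add: side_def n0)
  have dom_t: "dom (?t x0) = {?b}"
    using dom_transport[of x0 ?\<sigma> ?\<nu>] bV by (simp add: dom_x0 s_x0)
  have t_b: "?t x0 ?b = Some n0"
    using transport_pr[of b x0 ?\<sigma> ?\<nu>] bV by (simp add: dom_x0 s_x0 n0)
  have A'_x0: "A' ?b (?t x0)"
    using A'_iff[of b x0] A_x0 bang by (simp add: dom_x0 s_x0 only)
  have Ab: "A' ?b y \<longleftrightarrow> y ?b = Some n0" if "dom y = over P ?b" for y
  proof
    assume y: "y ?b = Some n0"
    have "y = [?b \<mapsto> n0]" "?t x0 = [?b \<mapsto> n0]"
      using that y dom_t t_b by (auto simp: over_b dom_eq_singleton_conv)
    then show "A' ?b y" using A'_x0 by simp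
  qed (use A'_b[of True y] in auto)
  \<comment> \<open>Tests after the drop are run with the forced label of the dropped !-vertex put
    back.\<close>
  define A'' where "A'' a y = A' a (if ?b \<in> over P a then y(?b \<mapsto> n0) else y)" for a y
  let ?R = "remove_verts (inflate P A') {v. fst v = ?b}"
  have R: "?R \<simeq> inflate ?D A''"
  proof (rule inflate_drop[OF box_graph_P bP, where n = n0])
    show "A' ?b y \<longleftrightarrow> y ?b = Some n0" if "dom y = over P ?b" for y
      using that by (rule Ab)
    fix a x
    assume a: "dom x = over P a" "?b \<in> over P a \<Longrightarrow> x ?b = Some n0"
    have "(if ?b \<in> over P a then (x |` (- {?b}))(?b \<mapsto> n0) else x |` (- {?b})) = x"
      using a domIff[of ?b x] by (auto simp: restrict_map_def fun_eq_iff)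
    then show "A' a x \<longleftrightarrow> A'' a (x |` (- {?b}))" by (simp add: A''_def)
  qed
  have "unbang (inflate G A) \<simeq> unbang (inflate ?D A'')"
    using tg_iso_trans[OF tg_iso_unbang[OF iso wf_digraph_inflate[OF box_graph]]
        unbang_inflate_drop[OF box_graph_P bP R]] .
  moreover have "finite (bang_verts (inflate ?D A'')) \<and>
      card (bang_verts (inflate ?D A'')) < card (bang_verts (inflate G A))"
    if fin: "finite (bang_verts (inflate G A))"
  proof -
    have "?t x0 |` {?b} = ?t x0"
      using dom_t by (auto simp: restrict_map_def fun_eq_iff domIff)
    then have "(?b, ?t x0) \<in> bang_verts (inflate P A')"
      using bP dom_t A'_x0 by (simp add: bang_verts_inflate labels_def over_b)
    moreover have "(?b, ?t x0) \<notin> bang_verts ?R" "bang_verts ?R \<subseteq> bang_verts (inflate P A')"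
      by (simp_all add: remove_verts_def)
    \<comment> \<open>The copy of \<open>?b\<close> labelled by \<open>?t x0\<close> is lost, which
      makes the inclusion strict.\<close>
    ultimately have "bang_verts ?R \<subset> bang_verts (inflate P A')"
      by (intro psubsetI) auto
    moreover have "finite (bang_verts (inflate P A'))"
      using fin tg_iso_card_bang_verts[OF iso] by simp
    ultimately have "finite (bang_verts ?R)" "card (bang_verts ?R) < card (bang_verts (inflate P A'))"
      by (auto intro: psubset_card_mono finite_subset)
    then show ?thesis
      using tg_iso_card_bang_verts[OF iso] tg_iso_card_bang_verts[OF R] by simp
  qed
  ultimately show ?thesis by blast
qed

lemma inflate_enf_reachable:
  fixes G :: "('v::infinite, 'e::infinite, 'o, 'm) tgraph"
  assumes "box_graph T G" "finite (bang_verts (inflate G A))"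
  shows "\<exists>K. (enf_step T)\<^sup>*\<^sup>* G K \<and> unbang (inflate G A) \<simeq> K"
  using assms
\<comment> \<open>The order is lexicographic: KILL preserves the inflation up to isomorphism, so
  only the second component falls, whereas EXP may add !-vertices to the graph but lowers the
  first.\<close>
proof (induction "(G, A)" arbitrary: G A rule: wf_induct_rule[OF wf_measures[of
      "[\<lambda>(G, A). card (bang_verts (inflate G A)), \<lambda>(G, A). card (bang_verts G)]"]])
  case (1 G A)
  note G = 1(2) and fin = 1(3)
  have IH: "\<exists>K. (enf_step T)\<^sup>*\<^sup>* G' K \<and> unbang (inflate G' A') \<simeq> K"
    if "card (bang_verts (inflate G' A')) < card (bang_verts (inflate G A)) \<or>
      card (bang_verts (inflate G' A')) = card (bang_verts (inflate G A)) \<and>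
      card (bang_verts G') < card (bang_verts G)"
      "box_graph T G'" "finite (bang_verts (inflate G' A'))" for G' :: "('v, 'e, 'o, 'm) tgraph" and A'
    using 1(1)[of G' A'] that by auto
  note wf_inflate = wf_digraph_inflate[OF G, of A]
  show ?case
  proof (cases "bang_verts G = {}")
    case True
    then have "unbang (inflate G A) \<simeq> G"
      using unbang_inflate_concrete[of G A] box_graphD(4)[OF G] tg_iso_sym
      by (auto simp: concrete_def)
    then show ?thesis by blast
  next
    case False
    then obtain b where b: "b \<in> bang_verts G" "depth G b = 0"
        "\<And>a. a \<in> bang_verts G \<Longrightarrow> (a, b) \<in> arcs_ends (und G) \<Longrightarrow> a = b"
      using ex_depth_zero[OF G] by blast
    have only: "over G b = {b}"
      using b box_graphD(5)[OF G] by (auto simp: over_def)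
    have step: "\<exists>K. (enf_step T)\<^sup>*\<^sup>* G K \<and> unbang (inflate G A) \<simeq> K"
      if "enf_step T G G'" "unbang (inflate G A) \<simeq> unbang (inflate G' A')"
        "\<exists>K. (enf_step T)\<^sup>*\<^sup>* G' K \<and> unbang (inflate G' A') \<simeq> K" for G' A'
      using that by (meson converse_rtranclp_into_rtranclp tg_iso_trans)
    show ?thesis
    proof (cases "labels G A (over G b) = {}")
      case True
      \<comment> \<open>The same \<open>A\<close> serves after the KILL, since vertices keep their
        names and only elements without copies disappear.\<close>
      have iso: "inflate G A \<simeq> inflate (kill_bang b G) A"
        using inflate_kill[OF G b(1) True] by simp
      have K: "kill_bang b G = full_sub G (- {v. (b, v) \<in> arcs_ends (und G)})"
        by (simp add: kill_bang_def remove_verts_def verts_bang_box[OF G])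
      have "bang_verts (kill_bang b G) \<subset> bang_verts G"
        using b(1) box_graphD(5)[OF G b(1)] by (auto simp: K)
      moreover have "finite (bang_verts G)"
        using box_graphD(1)[OF G] by (simp add: bang_verts_def)
      ultimately have less: "card (bang_verts (kill_bang b G)) < card (bang_verts G)"
        by (rule psubset_card_mono[rotated])
      show ?thesis
      proof (rule step)
        show "enf_step T G (kill_bang b G)" using b by (intro enf_step.kill)
        show "unbang (inflate G A) \<simeq> unbang (inflate (kill_bang b G) A)"
          by (rule tg_iso_unbang[OF iso wf_inflate])
        show "\<exists>K. (enf_step T)\<^sup>*\<^sup>* (kill_bang b G) K \<and> unbang (inflate (kill_bang b G) A) \<simeq> K"
          using less fin tg_iso_card_bang_verts[OF iso] box_graph_full_sub[OF G]
          by (intro IH) (simp_all add: K)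
      qed
    next
      case False
      then obtain x0 where x0: "x0 \<in> labels G A {b}" using only by auto
      obtain P pr pe where "box_copy T G b P pr pe" using ex_box_copy[OF G b(1)] .
      then interpret box_copy T G b P pr pe .
      let ?D = "drop_bang (pr True b) P"
      obtain A' where A': "unbang (inflate G A) \<simeq> unbang (inflate ?D A')"
          "finite (bang_verts (inflate ?D A'))"
          "card (bang_verts (inflate ?D A')) < card (bang_verts (inflate G A))"
        using exp_inflate[OF only x0] fin by blast
      show ?thesis
      proof (rule step[OF _ A'(1)])
        have "is_exp T b G ?D" using is_copy by (auto simp: is_exp_def)
        then show "enf_step T G ?D" using b by (intro enf_step.exp)
        have "box_graph T ?D"
          unfolding drop_bang_def remove_verts_def by (rule box_graph_full_sub[OF box_graph_P])
        then show "\<exists>K. (enf_step T)\<^sup>*\<^sup>* ?D K \<and> unbang (inflate ?D A') \<simeq> K"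
          using A' by (intro IH) simp_all
      qed
    qed
  qed
qed

theorem theorem6p13:
  fixes T :: "('o, 'm) signature"
    and G :: "('v::infinite, 'e::infinite, 'o, 'm) tgraph"
    and H :: "('w, 'd, 'o, 'm) tgraph"
  assumes "wf_signature T"
    and "bang_graph T G"
    and "concrete_instance_of T G H"
  shows "\<exists>K. (enf_step T)\<^sup>*\<^sup>* G K \<and> K \<simeq> H"
proof -
  have G: "box_graph T G" by (rule bang_graph_imp_box_graph[OF assms(2)])
  obtain K0 where K0: "(bang_step T)\<^sup>*\<^sup>* G K0" "K0 \<simeq> H" and "concrete H"
    using assms(3) by (auto simp: concrete_instance_of_def instance_of_def)
  \<comment> \<open>Isomorphisms preserve types, so a !-vertex of \<open>K0\<close> would give one
    of \<open>H\<close>.\<close>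
  have "concrete K0"
  proof -
    obtain f where "tg_hom K0 H f" using K0(2) by (auto simp: tg_iso_def)
    then show ?thesis
      using \<open>concrete H\<close> unfolding concrete_def bang_verts_def tg_hom_def graph_hom_def by fastforce
  qed
  then obtain A where A: "fin_names A" "unbang (inflate G A) \<simeq> K0"
    using concrete_instance_inflate[OF K0(1) G] by blast
  obtain K where K: "(enf_step T)\<^sup>*\<^sup>* G K" "unbang (inflate G A) \<simeq> K"
    using inflate_enf_reachable[OF G finite_bang_verts_inflate[OF G A(1)]] by blast
  have "wf_digraph (und (unbang (inflate G A)))"
    unfolding unbang_def remove_verts_def by (rule wf_digraph_full_sub[OF wf_digraph_inflate[OF G]])
  then have "K \<simeq> H"
    using tg_iso_trans[OF tg_iso_sym[OF K(2)] tg_iso_trans[OF A(2) K0(2)]] by blast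
  then show ?thesis using K(1) by blast
qed

end
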